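(* Let $m,n\in\mathbb{N}_0$ with $n\ge m$, $\sigma,\sigma'\in(0,\infty)$, and $\theta'\in(0,\pi)$. Then \[ \int_0^\pi Q_{m-1/2}(\chi)\,\mathrm{P}^m_n(\cos\theta)\sqrt{\sin\theta}\,d\theta =2\pi(-1)^m\frac{(n-m)!}{(n+m)!}\sqrt{\sinh\sigma\sinh\sigma'\sin\theta'}\;\mathrm{P}^m_n(\cos\theta')\,P^m_n(\cosh\sigma_<)\,Q^m_n(\cosh\sigma_>), \] where \[ \chi=\frac{\cosh^2\sigma+\cosh^2\sigma'-\sin^2\theta-\sin^2\theta'-2\cosh\sigma\cosh\sigma'\cos\theta\cos\theta'}{2\sinh\sigma\sinh\sigma'\sin\theta\sin\theta'} \] and $\sigma_<=\min\{\sigma,\sigma'\}$, $\sigma_>=\max\{\sigma,\sigma'\}$.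
   Context: For $z\in\mathbb{C}\setminus(-\infty,1]$ (principal branches, $\mathbf{F}={}_2F_1/\Gamma(c)$ regularized hypergeometric function): the associated Legendre functions are $P^\mu_\nu(z)=\left(\frac{z+1}{z-1}\right)^{\mu/2}\mathbf{F}\!\left(\nu+1,-\nu;1-\mu;\frac{1-z}{2}\right)$ and $Q^\mu_\nu(z)=e^{\mu\pi i}\frac{\sqrt{\pi}\,\Gamma(\nu+\mu+1)(z^2-1)^{\mu/2}}{2^{\nu+1}z^{\nu+\mu+1}}\,\mathbf{F}\!\left(\frac{\nu+\mu}{2}+1,\frac{\nu+\mu+1}{2};\nu+\frac32;\frac{1}{z^2}\right)$, and $Q_\nu=Q^0_\nu$. $\mathrm{P}^m_n$ is the Ferrers function of the first kind: for integers $0\le m\le n$ and $x\in(-1,1)$, $\mathrm{P}^m_n(x)=(-1)^m(1-x^2)^{m/2}\frac{d^m}{dx^m}P_n(x)$ with $P_n$ the Legendre polynomial. Note $\chi\ge1$, with $\chi=1$ only when $\sigma=\sigma'$ and $\theta=\theta'$ (where $Q_{m-1/2}(\chi)$ has an integrable logarithmic singularity). *)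

theory Defs
  imports "HOL-Analysis.Analysis"
begin

text \<open>Regularized Gauss hypergeometric function
  F(a,b;c;x) = sum_k (a)_k (b)_k / (Gamma(c+k) k!) x^k  (1/Gamma = rGamma, entire,
  vanishing at non-positive integers).\<close>
definition hyp2F1_reg :: "complex \<Rightarrow> complex \<Rightarrow> complex \<Rightarrow> complex \<Rightarrow> complex" where
  "hyp2F1_reg a b c x =
     (\<Sum>k. pochhammer a k * pochhammer b k * rGamma (c + of_nat k) / fact k * x ^ k)"

definition legendreP :: "complex \<Rightarrow> complex \<Rightarrow> complex \<Rightarrow> complex" where
  "legendreP \<mu> \<nu> z =
     ((z + 1) / (z - 1)) powr (\<mu> / 2) * hyp2F1_reg (\<nu> + 1) (- \<nu>) (1 - \<mu>) ((1 - z) / 2)"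

definition legendreQ :: "complex \<Rightarrow> complex \<Rightarrow> complex \<Rightarrow> complex" where
  "legendreQ \<mu> \<nu> z =
     exp (\<mu> * of_real pi * \<i>) * of_real (sqrt pi) * Gamma (\<nu> + \<mu> + 1) * (z\<^sup>2 - 1) powr (\<mu> / 2)
       / (2 powr (\<nu> + 1) * z powr (\<nu> + \<mu> + 1))
     * hyp2F1_reg ((\<nu> + \<mu>) / 2 + 1) ((\<nu> + \<mu> + 1) / 2) (\<nu> + 3 / 2) (1 / z\<^sup>2)"

text \<open>Legendre polynomial via Rodrigues' formula.\<close>
definition legendre_poly :: "nat \<Rightarrow> real \<Rightarrow> real" where
  "legendre_poly n x = (deriv ^^ n) (\<lambda>t. (t\<^sup>2 - 1) ^ n) x / (2 ^ n * fact n)"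

definition ferrersP :: "nat \<Rightarrow> nat \<Rightarrow> real \<Rightarrow> real" where
  "ferrersP m n x = (-1) ^ m * (1 - x\<^sup>2) powr (real m / 2) * (deriv ^^ m) (legendre_poly n) x"

definition chi :: "real \<Rightarrow> real \<Rightarrow> real \<Rightarrow> real \<Rightarrow> real" where
  "chi \<sigma> \<sigma>' \<theta> \<theta>' =
     ((cosh \<sigma>)\<^sup>2 + (cosh \<sigma>')\<^sup>2 - (sin \<theta>)\<^sup>2 - (sin \<theta>')\<^sup>2
        - 2 * cosh \<sigma> * cosh \<sigma>' * cos \<theta> * cos \<theta>')
     / (2 * sinh \<sigma> * sinh \<sigma>' * sin \<theta> * sin \<theta>')"

end

theory Submission
  imports Defs "HOL-Computational_Algebra.Polynomial"
begin

text \<open>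
  Put \<open>\<xi> = cosh \<sigma>\<close>, \<open>\<eta> = cosh \<sigma>'\<close>, \<open>x = cos \<theta>\<close>, \<open>y = cos \<theta>'\<close>. Up to a constant and a power of
  \<open>S = (1 - \<xi>\<^sup>2)(1 - \<eta>\<^sup>2)(1 - x\<^sup>2)(1 - y\<^sup>2)\<close>, the function \<open>Q\<^bsub>m-1/2\<^esub>(\<chi>)\<close> is a kernel \<open>G\<close> that depends only on
  \<open>S\<close> and \<open>D = \<xi>\<^sup>2 + \<eta>\<^sup>2 + x\<^sup>2 + y\<^sup>2 - 2 - 2\<xi>\<eta>xy\<close>, hence is symmetric in all four variables. The hypergeometric
  equation makes \<open>L\<^sub>v G\<close>, with \<open>L\<^sub>v = (1 - v\<^sup>2)\<partial>\<^sub>v\<^sup>2 - 2(m + 1)v\<partial>\<^sub>v\<close>, independent of the choice of the variable \<open>v\<close>.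
  Let \<open>p\<close> be the \<open>m\<close>-th derivative of the Legendre polynomial \<open>P\<^sub>n\<close>, an eigenfunction of the operator \<open>L\<close>,
  which is self-adjoint for the weight \<open>(1 - x\<^sup>2)\<^sup>m\<close>. For \<open>\<xi> < \<eta>\<close> the integral
  \<open>I(y, \<xi>) = \<integral> (1 - x\<^sup>2)\<^sup>m p(x) G dx\<close> therefore satisfies the equation of \<open>p\<close> in \<open>y\<close> and in \<open>\<xi>\<close>, and being
  regular at \<open>1\<close> it is \<open>p(y) p(\<xi>) I(1, 1) / p(1)\<^sup>2\<close>. Finally \<open>I(1, 1) = \<integral> (1 - x\<^sup>2)\<^sup>m p(x) (\<eta> - x)\<^bsup>-2m-1\<^esup> dx\<close>
  is a multiple of \<open>Q\<^sub>n\<^sup>m(\<eta>)\<close> by Rodrigues' formula, and the case \<open>\<sigma> = \<sigma>'\<close> follows by dominated convergence.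
\<close>

subsection \<open>Derivatives of Legendre polynomials\<close>

text \<open>Let (R, z) = (sinh \<sigma> sin \<theta>, cosh \<sigma> cos \<theta>), and likewise (R',
  z'). Then Q_(m-1/2)(\<chi>) / sqrt(R R') is, up to a constant, the m-th azimuthal Fourier
  coefficient of the Newton potential of two points in prolate spheroidal coordinates. Laplace's
  equation, separated, gives the equality of the operators for the two coordinates of one point;
  exchanging \<xi> and \<eta> extends it to all four variables. Dividing further by (R R')^m turns
  the associated Legendre operator into L and keeps G smooth at S = 0. This makes the evaluation at
  y = \<xi> = 1 possible, where only the leading hypergeometric coefficient survives. The obstacle
  is D^2 = 4 S, where the hypergeometric argument reaches 1. For \<xi> < \<eta> it is avoided on the
  whole closed square, so every differentiation under the integral happens there; equality enters
  only through a limit without derivatives. Uniqueness takes two arguments: p has zeros in (-1, 1)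
  if m < n, so division by p works on [1, \<eta>) only, and an energy estimate replaces it on
  [-1, 1].\<close>

lemma poly_higher_pderiv_root:
  fixes q :: "real poly"
  shows "k \<le> n \<Longrightarrow> poly ((pderiv ^^ k) ([:- a, 1:] ^ n * q)) a = (if k = n then fact n * poly q a else 0)"
proof (induction n arbitrary: k q)
  case 0
  then show ?case by simp
next
  case (Suc n)
  show ?case
  proof (cases k)
    case 0
    then show ?thesis by simp
  next
    case (Suc k')
    \<comment> \<open>Differentiation lowers the order of the root by one; \<open>q'\<close> is the
      new cofactor, and its value at the root contributes the next factor of the factorial.\<close>
    define q' where "q' = smult (of_nat (Suc n)) q + [:- a, 1:] * pderiv q"
    have p1: "pderiv [:- a, 1:] = 1"
      by (simp add: pderiv_pCons)
    have "pderiv ([:- a, 1:] ^ Suc n * q) = [:- a, 1:] ^ n * q'"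
      unfolding pderiv_mult pderiv_power_Suc p1 q'_def by (simp add: algebra_simps)
    then have "(pderiv ^^ k) ([:- a, 1:] ^ Suc n * q) = (pderiv ^^ k') ([:- a, 1:] ^ n * q')"
      by (simp only: Suc funpow_Suc_right o_def)
    moreover have "poly q' a = of_nat (Suc n) * poly q a"
      by (simp add: q'_def)
    ultimately show ?thesis
      using Suc.IH[of k' q'] Suc.prems Suc by auto
  qed
qed

lemma poly_taylor:
  fixes p :: "real poly"
  assumes "degree p \<le> N"
  shows "poly p x = (\<Sum>j\<le>N. poly ((pderiv ^^ j) p) a / fact j * (x - a) ^ j)"
proof -
  define q where "q = pcompose p [:a, 1:]"
  have comp: "(pderiv ^^ j) q = pcompose ((pderiv ^^ j) p) [:a, 1:]" for j
    by (induction j) (simp_all add: q_def pderiv_pcompose pderiv_pCons)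
  have coeff_q: "coeff q j = poly ((pderiv ^^ j) p) a / fact j" for j
  proof -
    have "poly ((pderiv ^^ j) p) a = coeff ((pderiv ^^ j) q) 0"
      by (simp add: comp poly_pcompose flip: poly_0_coeff_0)
    also have "\<dots> = fact j * coeff q j"
      by (simp add: coeff_higher_pderiv pochhammer_fact)
    finally show ?thesis by simp
  qed
  have "degree q \<le> N"
    using assms by (simp add: q_def degree_pcompose)
  have "poly p x = poly q (x - a)"
    by (simp add: q_def poly_pcompose)
  also have "\<dots> = (\<Sum>j\<le>N. coeff q j * (x - a) ^ j)"
    using \<open>degree q \<le> N\<close>
    by (auto simp: poly_altdef le_degree intro!: sum.mono_neutral_left)
  finally show ?thesis by (simp add: coeff_q)
qed

lemma higher_deriv_poly: "(deriv ^^ k) (poly p) = poly ((pderiv ^^ k) (p :: real poly))"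
proof (induction k)
  case (Suc k)
  show ?case
    unfolding funpow.simps o_def Suc.IH by (auto simp: fun_eq_iff intro!: DERIV_imp_deriv poly_DERIV)
qed simp

section \<open>Derivatives of (x^2 - 1)^n\<close>

definition rodrigues :: "nat \<Rightarrow> nat \<Rightarrow> real poly" where
  "rodrigues n k = (pderiv ^^ k) ([:-1, 0, 1:] ^ n)"

lemma pderiv_rodrigues [simp]: "pderiv (rodrigues n k) = rodrigues n (Suc k)"
  by (simp add: rodrigues_def)

lemma square_minus_one_factors:
  "[:-1, 0, 1:] ^ n = [:- 1, 1:] ^ n * ([:1, 1:] ^ n :: real poly)"
  "[:-1, 0, 1:] ^ n = [:- (-1), 1:] ^ n * ([:-1, 1:] ^ n :: real poly)"
  by (simp_all flip: power_mult_distrib)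

lemma rodrigues_eq_0: "k < n \<Longrightarrow> poly (rodrigues n k) 1 = 0" "k < n \<Longrightarrow> poly (rodrigues n k) (-1) = 0"
  using poly_higher_pderiv_root[of k n 1 "[:1, 1:] ^ n"] poly_higher_pderiv_root[of k n "-1" "[:-1, 1:] ^ n"]
  by (simp_all add: rodrigues_def square_minus_one_factors(1)) (simp_all add: mult.commute)

lemma rodrigues_at_1: "poly (rodrigues n n) 1 = 2 ^ n * fact n"
  using poly_higher_pderiv_root[of n n 1 "[:1, 1:] ^ n"]
  by (simp add: rodrigues_def square_minus_one_factors(1))

text \<open>For f = (x^2 - 1)^n one has (x^2 - 1) f' = 2 n x f; differentiating this k + 1 times
  gives the equation.\<close>

lemma rodrigues_ode:
  "(x\<^sup>2 - 1) * poly (rodrigues n (Suc (Suc k))) x + 2 * (real k + 1 - real n) * x * poly (rodrigues n (Suc k)) x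
     + (real k + 1) * (real k - 2 * real n) * poly (rodrigues n k) x = 0"
proof (induction k arbitrary: x)
  case 0
  have base: "(x\<^sup>2 - 1) * poly (rodrigues n 1) x = 2 * real n * x * poly (rodrigues n 0) x" for x
  proof (cases n)
    case (Suc k)
    then show ?thesis
      by (simp add: rodrigues_def pderiv_power_Suc pderiv_pCons del: power_Suc)
         (simp add: power2_eq_square algebra_simps)
  qed (simp add: rodrigues_def)
  have "((\<lambda>x. (x\<^sup>2 - 1) * poly (rodrigues n 1) x) has_real_derivative
           2 * x * poly (rodrigues n 1) x + (x\<^sup>2 - 1) * poly (rodrigues n 2) x) (at x)"
    by (auto intro!: derivative_eq_intros simp: numeral_2_eq_2)
  moreover have "((\<lambda>x. 2 * real n * x * poly (rodrigues n 0) x) has_real_derivative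
           2 * real n * poly (rodrigues n 0) x + 2 * real n * x * poly (rodrigues n 1) x) (at x)"
    by (auto intro!: derivative_eq_intros)
  ultimately have "2 * x * poly (rodrigues n 1) x + (x\<^sup>2 - 1) * poly (rodrigues n 2) x
      = 2 * real n * poly (rodrigues n 0) x + 2 * real n * x * poly (rodrigues n 1) x"
    unfolding base by (rule DERIV_unique)
  then show ?case by (simp add: numeral_2_eq_2 algebra_simps)
next
  case (Suc k)
  let ?f = "\<lambda>x. (x\<^sup>2 - 1) * poly (rodrigues n (Suc (Suc k))) x
      + 2 * (real k + 1 - real n) * x * poly (rodrigues n (Suc k)) x
      + (real k + 1) * (real k - 2 * real n) * poly (rodrigues n k) x"
  have "(?f has_real_derivative
      2 * x * poly (rodrigues n (Suc (Suc k))) x + (x\<^sup>2 - 1) * poly (rodrigues n (Suc (Suc (Suc k)))) x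
      + (2 * (real k + 1 - real n) * poly (rodrigues n (Suc k)) x
      + 2 * (real k + 1 - real n) * x * poly (rodrigues n (Suc (Suc k))) x)
      + (real k + 1) * (real k - 2 * real n) * poly (rodrigues n (Suc k)) x) (at x)"
    by (auto intro!: derivative_eq_intros)
  moreover have "(?f has_real_derivative 0) (at x)"
    unfolding Suc.IH by simp
  ultimately have "2 * x * poly (rodrigues n (Suc (Suc k))) x + (x\<^sup>2 - 1) * poly (rodrigues n (Suc (Suc (Suc k)))) x
      + (2 * (real k + 1 - real n) * poly (rodrigues n (Suc k)) x
      + 2 * (real k + 1 - real n) * x * poly (rodrigues n (Suc (Suc k))) x)
      + (real k + 1) * (real k - 2 * real n) * poly (rodrigues n (Suc k)) x = 0"
    by (rule DERIV_unique)
  then show ?case by (simp add: algebra_simps)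
qed

text \<open>This is the relation between the orders m and -m. In the induction step both sides have
  the same derivative by \<open>rodrigues_ode\<close>, and both vanish at 1. It turns the weight
  times p into a derivative of order n - m, low enough for integration by parts without boundary
  terms.\<close>

lemma rodrigues_reflect:
  assumes "m \<le> n"
  shows "(x\<^sup>2 - 1) ^ m * poly (rodrigues n (n + m)) x * fact (n - m) = fact (n + m) * poly (rodrigues n (n - m)) x"
  using assms
proof (induction m arbitrary: x)
  case 0
  then show ?case by simp
next
  case (Suc m)
  define f where "f x = (x\<^sup>2 - 1) ^ Suc m * poly (rodrigues n (n + Suc m)) x * fact (n - Suc m)
     - fact (n + Suc m) * poly (rodrigues n (n - Suc m)) x" for x :: real
  have nm: "Suc (n - Suc m) = n - m"
    using Suc.prems by simp
  have ode: "(x\<^sup>2 - 1) * poly (rodrigues n (Suc (Suc (n + m)))) x + 2 * (real m + 1) * x * poly (rodrigues n (Suc (n + m))) x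
     = (real n + real m + 1) * (real n - real m) * poly (rodrigues n (n + m)) x" for x
    using rodrigues_ode[of x n "n + m"] by (simp add: algebra_simps)
  have fm: "fact (n - m) = (real n - real m) * fact (n - Suc m)"
    using Suc.prems by (simp add: fact_reduce of_nat_diff)
  have "(f has_real_derivative 0) (at x)" for x
  proof -
    have "(f has_real_derivative
       (x\<^sup>2 - 1) ^ m * ((x\<^sup>2 - 1) * poly (rodrigues n (Suc (Suc (n + m)))) x
          + 2 * (real m + 1) * x * poly (rodrigues n (Suc (n + m))) x) * fact (n - Suc m)
       - fact (n + Suc m) * poly (rodrigues n (n - m)) x) (at x)"
      unfolding f_def by (auto intro!: derivative_eq_intros simp: nm simp del: power_Suc)
        (simp add: algebra_simps)
    also have "(x\<^sup>2 - 1) ^ m * ((x\<^sup>2 - 1) * poly (rodrigues n (Suc (Suc (n + m)))) x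
          + 2 * (real m + 1) * x * poly (rodrigues n (Suc (n + m))) x) * fact (n - Suc m)
        = (real n + real m + 1) * ((x\<^sup>2 - 1) ^ m * poly (rodrigues n (n + m)) x * fact (n - m))"
      unfolding ode fm by simp
    also have "\<dots> = fact (n + Suc m) * poly (rodrigues n (n - m)) x"
      using Suc by (simp add: algebra_simps)
    finally show ?thesis by simp
  qed
  then have "f x = f 1"
    by (intro DERIV_isconst_all) auto
  also have "f 1 = 0"
    using Suc.prems by (simp add: f_def rodrigues_eq_0)
  finally show ?case by (simp add: f_def)
qed

section \<open>Derivatives of the Legendre polynomial and their expansion at 1\<close>

definition dlegendre :: "nat \<Rightarrow> nat \<Rightarrow> real poly" where
  "dlegendre m n = smult (1 / (2 ^ n * fact n)) (rodrigues n (n + m))"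

lemma pderiv_dlegendre [simp]: "pderiv (dlegendre m n) = dlegendre (Suc m) n"
  by (simp add: dlegendre_def pderiv_smult)

lemma higher_pderiv_dlegendre: "(pderiv ^^ k) (dlegendre m n) = dlegendre (m + k) n"
  by (induction k) auto

lemma ferrersP_eq_poly:
  "ferrersP m n x = (-1) ^ m * (1 - x\<^sup>2) powr (real m / 2) * poly (dlegendre m n) x"
proof -
  have base: "(\<lambda>t. (t\<^sup>2 - 1) ^ n) = poly ([:-1, 0, 1:] ^ n :: real poly)"
    by (auto simp: fun_eq_iff power2_eq_square)
  have "legendre_poly n = poly (dlegendre 0 n)"
    unfolding legendre_poly_def base higher_deriv_poly
    by (auto simp: fun_eq_iff dlegendre_def rodrigues_def)
  then show ?thesis
    by (simp add: ferrersP_def higher_deriv_poly higher_pderiv_dlegendre)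
qed

lemma dlegendre_ode:
  "(1 - x\<^sup>2) * poly (dlegendre (Suc (Suc m)) n) x - 2 * (real m + 1) * x * poly (dlegendre (Suc m) n) x
     = - ((real n - real m) * (real n + real m + 1)) * poly (dlegendre m n) x"
proof -
  define c :: real where "c = 1 / (2 ^ n * fact n)"
  have "c * ((x\<^sup>2 - 1) * poly (rodrigues n (Suc (Suc (n + m)))) x
      + 2 * (real m + 1) * x * poly (rodrigues n (Suc (n + m))) x
      + (real n + real m + 1) * (real m - real n) * poly (rodrigues n (n + m)) x) = 0"
    using rodrigues_ode[of x n "n + m"] by (simp add: algebra_simps)
  then show ?thesis
    unfolding dlegendre_def c_def[symmetric] by (simp add: algebra_simps)
qed

text \<open>At x = 1 the second-order term of \<open>dlegendre_ode\<close> drops out, which leaves a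
  recursion in m.\<close>

lemma dlegendre_at_1:
  assumes "m \<le> n"
  shows "poly (dlegendre m n) 1 = fact (n + m) / (fact (n - m) * fact m * 2 ^ m)"
  using assms
proof (induction m)
  case 0
  then show ?case by (simp add: dlegendre_def rodrigues_at_1)
next
  case (Suc m)
  have fm: "fact (n - m) = (real n - real m) * fact (n - Suc m)" "real n - real m > 0"
    using Suc.prems by (simp_all add: fact_reduce of_nat_diff)
  have "2 * (real m + 1) * poly (dlegendre (Suc m) n) 1
      = (real n - real m) * (real n + real m + 1) * (fact (n + m) / (fact (n - m) * fact m * 2 ^ m))"
    using dlegendre_ode[of 1 m n] Suc by simp
  also have "\<dots> = (2 * (real m + 1)) * (fact (n + Suc m) / (fact (n - Suc m) * fact (Suc m) * 2 ^ Suc m))"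
  proof -
    have gen: "d * e * (f / (d * A * B * c)) = (2 * l) * ((e * f) / (A * (l * B) * (2 * c)))"
      if "d \<noteq> 0" "l \<noteq> 0" for A B c d e f l :: real
      using that by simp
    have facts: "fact (n + Suc m) = (real n + real m + 1) * fact (n + m)" "fact (Suc m) = (real m + 1) * fact m"
      by (simp_all add: algebra_simps)
    show ?thesis
      unfolding fm(1) facts power_Suc by (rule gen) (use fm(2) in auto)
  qed
  finally show ?case
    by (subst (asm) mult_cancel_left) auto
qed

text \<open>Expansion at 1 serves twice: all coefficients are positive, whence
  \<open>dlegendre_pos\<close>, and the terms are those of the hypergeometric series in
  \<open>legendreP\<close>.\<close>

lemma dlegendre_taylor:
  "poly (dlegendre m n) x =
     (\<Sum>j\<le>n - m. fact (n + m + j) / (fact (n - m - j) * fact (m + j) * fact j * 2 ^ (m + j)) * (x - 1) ^ j)"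
  if "m \<le> n"
proof -
  have "degree (dlegendre m n) \<le> n - m"
  proof -
    have "degree (rodrigues n (n + m)) = degree ([:-1, 0, 1:] ^ n :: real poly) - (n + m)"
      unfolding rodrigues_def by (rule degree_higher_pderiv)
    also have "\<dots> \<le> 2 * n - (n + m)"
      by (intro diff_le_mono order.trans[OF degree_power_le]) auto
    finally show ?thesis
      by (simp add: dlegendre_def)
  qed
  then have "poly (dlegendre m n) x = (\<Sum>j\<le>n - m. poly (dlegendre (m + j) n) 1 / fact j * (x - 1) ^ j)"
    using poly_taylor[of "dlegendre m n" "n - m" x 1] by (simp add: higher_pderiv_dlegendre)
  also have "\<dots> = (\<Sum>j\<le>n - m. fact (n + m + j) / (fact (n - m - j) * fact (m + j) * fact j * 2 ^ (m + j)) * (x - 1) ^ j)"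
  proof (rule sum.cong[OF refl])
    fix j assume "j \<in> {..n - m}"
    then have "m + j \<le> n" using that by auto
    then show "poly (dlegendre (m + j) n) 1 / fact j * (x - 1) ^ j
        = fact (n + m + j) / (fact (n - m - j) * fact (m + j) * fact j * 2 ^ (m + j)) * (x - 1) ^ j"
      by (simp add: dlegendre_at_1 add.assoc mult_ac)
  qed
  finally show ?thesis .
qed

lemma dlegendre_pos:
  assumes "m \<le> n" "x \<ge> 1"
  shows "poly (dlegendre m n) x > 0"
  unfolding dlegendre_taylor[OF assms(1)]
  by (rule sum_pos2[of _ 0]) (use assms in \<open>auto intro!: mult_nonneg_nonneg divide_nonneg_nonneg\<close>)

subsection \<open>The hypergeometric series of the toroidal function\<close>

definition power_sum :: "(nat \<Rightarrow> real) \<Rightarrow> real \<Rightarrow> real" where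
  "power_sum c u = (\<Sum>k. c k * u ^ k)"

lemma power_sum_0 [simp]: "power_sum c 0 = c 0"
  by (simp add: power_sum_def)

lemma summable_diffs:
  fixes c :: "nat \<Rightarrow> real"
  assumes "\<And>z. \<bar>z\<bar> < 1 \<Longrightarrow> summable (\<lambda>k. c k * z ^ k)" "\<bar>u\<bar> < 1"
  shows "summable (\<lambda>k. diffs c k * u ^ k)"
  by (rule termdiff_converges[of u 1]) (use assms in auto)

lemma power_sum_deriv:
  assumes "\<And>z. \<bar>z\<bar> < 1 \<Longrightarrow> summable (\<lambda>k. c k * z ^ k)" "\<bar>u\<bar> < 1"
  shows "(power_sum c has_real_derivative power_sum (diffs c) u) (at u)"
  unfolding power_sum_def by (rule termdiffs_strong'[of 1]) (use assms in auto)

text \<open>Coefficients of \<open>\<^sub>2F\<^sub>1(m/2 + 1/4, m/2 + 3/4; m + 1; u)\<close>.\<close>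
definition ring_coeff :: "nat \<Rightarrow> nat \<Rightarrow> real" where
  "ring_coeff m k = pochhammer ((real m + 1/2) / 2) k * pochhammer ((real m + 3/2) / 2) k
     / (pochhammer (real m + 1) k * fact k)"

lemma ring_coeff_0 [simp]: "ring_coeff m 0 = 1"
  by (simp add: ring_coeff_def)

lemma ring_coeff_pos: "ring_coeff m k > 0"
  unfolding ring_coeff_def by (intro divide_pos_pos mult_pos_pos pochhammer_pos) auto

lemma ring_coeff_Suc:
  "(real k + 1) * (real k + real m + 1) * ring_coeff m (Suc k)
     = (real k + (real m + 1/2) / 2) * (real k + (real m + 3/2) / 2) * ring_coeff m k"
proof -
  have gen: "l * q * (A * a * (B * b) / (C * q * (l * f))) = a * b * (A * B / (C * f))"
    if "l \<noteq> 0" "q \<noteq> 0" for l q A B C a b f :: real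
    using that by simp
  have "real m + 1 + real k \<noteq> 0" "1 + real k \<noteq> 0" by auto
  from gen[OF this(2,1)] show ?thesis
    by (simp add: ring_coeff_def pochhammer_Suc add_ac)
qed

text \<open>The exponent \<open>1/4\<close> could be replaced by any positive number: the series has a logarithmic
  singularity at \<open>1\<close>.\<close>
lemma ring_coeff_bound:
  obtains C where "C > 0" "\<And>k. ring_coeff m k \<le> C * (pochhammer (1/4) k / fact k)"
proof -
  define e :: "nat \<Rightarrow> real" where "e k = pochhammer (1/4) k / fact k" for k
  \<comment> \<open>From index (m + 1)^2 on, the ratio of consecutive \<open>ring_coeff\<close> is
    at most that of \<open>e\<close>. The finitely many earlier quotients are all below their sum
    \<open>C\<close>.\<close>
  define K where "K = (m + 1)\<^sup>2"
  define C where "C = (\<Sum>k\<le>K. ring_coeff m k / e k)"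
  have e_pos: "e k > 0" for k
    unfolding e_def by (intro divide_pos_pos pochhammer_pos) auto
  have e_Suc: "(real k + 1) * e (Suc k) = (real k + 1/4) * e k" for k
  proof -
    have "l * (A * a / (l * f)) = a * (A / f)" if "l \<noteq> 0" for l A a f :: real
      using that by simp
    from this[of "1 + real k"] show ?thesis
      by (simp add: e_def pochhammer_Suc add_ac)
  qed
  have le: "ring_coeff m k \<le> C * e k" for k
  proof (induction k)
    case 0
    have "ring_coeff m 0 / e 0 \<le> C"
      unfolding C_def by (rule member_le_sum) (auto intro!: divide_nonneg_nonneg less_imp_le[OF e_pos] less_imp_le[OF ring_coeff_pos])
    then show ?case using e_pos[of 0] by (simp add: field_simps)
  next
    case (Suc k)
    show ?case
    proof (cases "Suc k \<le> K")
      case True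
      have "ring_coeff m (Suc k) / e (Suc k) \<le> C"
        unfolding C_def using True
        by (intro member_le_sum) (auto intro!: divide_nonneg_nonneg less_imp_le[OF e_pos] less_imp_le[OF ring_coeff_pos])
      then show ?thesis using e_pos[of "Suc k"] by (simp add: field_simps)
    next
      case False
      then have "real K \<le> real k" by simp
      then have K: "(real m + 1) * (real m + 1) \<le> real k" by (simp add: K_def power2_eq_square algebra_simps)
      have "(real k + 1) * (real k + real m + 1) * ring_coeff m (Suc k)
          = (real k + (real m + 1/2) / 2) * (real k + (real m + 3/2) / 2) * ring_coeff m k"
        by (rule ring_coeff_Suc)
      also have "\<dots> \<le> (real k + 1/4) * (real k + real m + 1) * ring_coeff m k"
      proof (intro mult_right_mono less_imp_le[OF ring_coeff_pos])
        have "(real k + (real m + 1/2) / 2) * (real k + (real m + 3/2) / 2)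
            = real k * (real k + real m + 1) + ((real m + 1) * (real m + 1) - 1/4) / 4"
          by (simp add: field_simps)
        also have "\<dots> \<le> real k * (real k + real m + 1) + (real k + real m + 1) / 4"
          using K by simp
        also have "\<dots> = (real k + 1/4) * (real k + real m + 1)"
          by (simp add: field_simps)
        finally show "(real k + (real m + 1/2) / 2) * (real k + (real m + 3/2) / 2)
            \<le> (real k + 1/4) * (real k + real m + 1)" .
      qed
      also have "\<dots> \<le> (real k + 1/4) * (real k + real m + 1) * (C * e k)"
        using Suc by (intro mult_left_mono) auto
      also have "\<dots> = (real k + real m + 1) * C * ((real k + 1/4) * e k)"
        by simp
      also have "\<dots> = (real k + 1) * (real k + real m + 1) * (C * e (Suc k))"
        by (simp flip: e_Suc)
      finally show ?thesis
        by (subst (asm) mult_le_cancel_left_pos) auto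
    qed
  qed
  have "0 < C * e 0" using le[of 0] by simp
  then have "C > 0" using e_pos[of 0] by (simp add: zero_less_mult_iff)
  then show ?thesis using that le by (simp add: e_def)
qed

lemma pochhammer_quarter_sums:
  fixes u :: real
  assumes "\<bar>u\<bar> < 1"
  shows "(\<lambda>k. pochhammer (1/4) k / fact k * u ^ k) sums ((1 - u) powr (-1/4))"
proof -
  have "(\<lambda>k. ((-1/4) gchoose k) * (-u) ^ k) sums ((1 + -u) powr (-1/4))"
    by (rule gen_binomial_real) (use assms in simp)
  moreover have "((-1/4) gchoose k) * (-u) ^ k = pochhammer (1/4) k / fact k * u ^ k" for k
  proof -
    have "((-1/4) gchoose k) * (-u) ^ k = (-1) ^ k * (-u) ^ k * (pochhammer (1/4) k / fact k)"
      by (simp add: gbinomial_pochhammer)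
    also have "(-1) ^ k * (-u) ^ k = u ^ k"
      by (simp flip: power_mult_distrib)
    finally show ?thesis by simp
  qed
  ultimately show ?thesis by simp
qed

lemma summable_ring_coeff:
  assumes "\<bar>u\<bar> < 1"
  shows "summable (\<lambda>k. ring_coeff m k * u ^ k)"
proof -
  obtain C where C: "C > 0" "\<And>k. ring_coeff m k \<le> C * (pochhammer (1/4) k / fact k)"
    using ring_coeff_bound by blast
  have "summable (\<lambda>k. C * (pochhammer (1/4) k / fact k * \<bar>u\<bar> ^ k))"
    using pochhammer_quarter_sums[of "\<bar>u\<bar>"] assms by (intro summable_mult) (auto simp: sums_iff)
  moreover have "norm (ring_coeff m k * u ^ k) \<le> C * (pochhammer (1/4) k / fact k * \<bar>u\<bar> ^ k)" for k
    using mult_right_mono[OF C(2)[of k], of "\<bar>u\<bar> ^ k"] ring_coeff_pos[of m k]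
    by (simp add: abs_mult power_abs)
  ultimately show ?thesis
    by (rule summable_comparison_test'[of _ 0])
qed

lemma ring_series_bound:
  obtains C where "C > 0"
    "\<And>u. 0 \<le> u \<Longrightarrow> u < 1 \<Longrightarrow> 0 \<le> power_sum (ring_coeff m) u \<and> power_sum (ring_coeff m) u \<le> C * (1 - u) powr (-1/4)"
proof -
  obtain C where C: "C > 0" "\<And>k. ring_coeff m k \<le> C * (pochhammer (1/4) k / fact k)"
    using ring_coeff_bound by blast
  have "0 \<le> power_sum (ring_coeff m) u \<and> power_sum (ring_coeff m) u \<le> C * (1 - u) powr (-1/4)"
    if u: "0 \<le> u" "u < 1" for u
  proof
    note sums = sums_mult[OF pochhammer_quarter_sums, of u C]
    show "0 \<le> power_sum (ring_coeff m) u"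
      unfolding power_sum_def using u summable_ring_coeff[of u m]
      by (intro suminf_nonneg) (auto intro!: mult_nonneg_nonneg less_imp_le[OF ring_coeff_pos])
    have "power_sum (ring_coeff m) u \<le> (\<Sum>k. C * (pochhammer (1/4) k / fact k * u ^ k))"
      unfolding power_sum_def
    proof (rule suminf_le)
      show "ring_coeff m k * u ^ k \<le> C * (pochhammer (1/4) k / fact k * u ^ k)" for k
        using mult_right_mono[OF C(2)[of k], of "u ^ k"] u by simp
      show "summable (\<lambda>k. ring_coeff m k * u ^ k)"
        using u by (intro summable_ring_coeff) auto
      show "summable (\<lambda>k. C * (pochhammer (1/4) k / fact k * u ^ k))"
        using sums u by (intro sums_summable[of _ "C * (1 - u) powr (-1/4)"]) auto
    qed
    also have "\<dots> = C * (1 - u) powr (-1/4)"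
      using sums u by (intro sums_unique[symmetric]) auto
    finally show "power_sum (ring_coeff m) u \<le> C * (1 - u) powr (-1/4)" .
  qed
  with \<open>C > 0\<close> that show ?thesis by blast
qed

lemma ring_series_deriv:
  assumes "\<bar>u\<bar> < 1"
  shows "(power_sum (ring_coeff m) has_real_derivative power_sum (diffs (ring_coeff m)) u) (at u)"
    and "(power_sum (diffs (ring_coeff m)) has_real_derivative power_sum (diffs (diffs (ring_coeff m))) u) (at u)"
    and "isCont (power_sum (diffs (diffs (ring_coeff m)))) u"
proof -
  show "(power_sum (ring_coeff m) has_real_derivative power_sum (diffs (ring_coeff m)) u) (at u)"
    by (intro power_sum_deriv summable_ring_coeff assms)
  show "(power_sum (diffs (ring_coeff m)) has_real_derivative power_sum (diffs (diffs (ring_coeff m))) u) (at u)"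
    by (intro power_sum_deriv summable_diffs summable_ring_coeff assms)
  have "(power_sum (diffs (diffs (ring_coeff m))) has_real_derivative
      power_sum (diffs (diffs (diffs (ring_coeff m)))) u) (at u)"
    by (intro power_sum_deriv summable_diffs summable_ring_coeff assms)
  then show "isCont (power_sum (diffs (diffs (ring_coeff m)))) u"
    by (rule DERIV_isCont)
qed

text \<open>Coefficientwise this is \<open>ring_coeff_Suc\<close>: the left side collects the terms
  of the hypergeometric equation that lower the degree by one, the right side those that keep
  it.\<close>

lemma ring_series_ode:
  fixes m :: nat and u :: real
  defines "a \<equiv> (real m + 1/2) / 2" and "b \<equiv> (real m + 3/2) / 2"
  defines "f0 \<equiv> power_sum (ring_coeff m) u" and "f1 \<equiv> power_sum (diffs (ring_coeff m)) u"
    and "f2 \<equiv> power_sum (diffs (diffs (ring_coeff m))) u"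
  assumes u: "\<bar>u\<bar> < 1"
  shows "u * f2 + (real m + 1) * f1 = u\<^sup>2 * f2 + (a + b + 1) * u * f1 + a * b * f0"
proof -
  let ?c = "ring_coeff m"
  have s1: "summable (\<lambda>k. diffs ?c k * u ^ k)"
    by (intro summable_diffs summable_ring_coeff u)
  have s2: "summable (\<lambda>k. diffs (diffs ?c) k * u ^ k)"
    by (intro summable_diffs summable_ring_coeff u)
  have S0: "(\<lambda>k. ?c k * u ^ k) sums f0"
    unfolding f0_def power_sum_def using summable_ring_coeff[OF u] by (rule summable_sums)
  have S1: "(\<lambda>k. (real k + 1) * ?c (Suc k) * u ^ k) sums f1"
    using summable_sums[OF s1] by (simp add: f1_def power_sum_def diffs_def add_ac)
  have S2: "(\<lambda>k. (real k + 1) * (real k + 2) * ?c (Suc (Suc k)) * u ^ k) sums f2"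
    using summable_sums[OF s2] by (simp add: f2_def power_sum_def diffs_def add_ac mult_ac)
  \<comment> \<open>The factor k annihilates the term of index 0, so multiplication by u is a pure
    index shift; the same holds for the next two series.\<close>
  have shift1: "(\<lambda>k. real k * ?c k * u ^ k) sums (u * f1)"
    using sums_Suc[of "\<lambda>k. real k * ?c k * u ^ k" "u * f1"] sums_mult[OF S1, of u] by (simp add: algebra_simps)
  have shift2: "(\<lambda>k. real k * (real k + 1) * ?c (Suc k) * u ^ k) sums (u * f2)"
    using sums_Suc[of "\<lambda>k. real k * (real k + 1) * ?c (Suc k) * u ^ k" "u * f2"] sums_mult[OF S2, of u]
    by (simp add: algebra_simps)
  have shift3: "(\<lambda>k. real k * (real k - 1) * ?c k * u ^ k) sums (u\<^sup>2 * f2)"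
    using sums_Suc[of "\<lambda>k. real k * (real k - 1) * ?c k * u ^ k" "u\<^sup>2 * f2"] sums_mult[OF shift2, of u]
    by (simp add: algebra_simps power2_eq_square)
  have "(\<lambda>k. real k * (real k + 1) * ?c (Suc k) * u ^ k + (real m + 1) * ((real k + 1) * ?c (Suc k) * u ^ k))
      sums (u * f2 + (real m + 1) * f1)"
    by (intro sums_add sums_mult shift2 S1)
  moreover have "(\<lambda>k. real k * (real k - 1) * ?c k * u ^ k + (a + b + 1) * (real k * ?c k * u ^ k) + a * b * (?c k * u ^ k))
      sums (u\<^sup>2 * f2 + (a + b + 1) * (u * f1) + a * b * f0)"
    by (intro sums_add sums_mult shift1 shift3 S0)
  moreover have "real k * (real k + 1) * ?c (Suc k) * u ^ k + (real m + 1) * ((real k + 1) * ?c (Suc k) * u ^ k)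
     = real k * (real k - 1) * ?c k * u ^ k + (a + b + 1) * (real k * ?c k * u ^ k) + a * b * (?c k * u ^ k)" for k
  proof -
    have "real k * (real k + 1) * ?c (Suc k) * u ^ k + (real m + 1) * ((real k + 1) * ?c (Suc k) * u ^ k)
        = ((real k + 1) * (real k + real m + 1) * ?c (Suc k)) * u ^ k"
      by (simp add: algebra_simps)
    also have "\<dots> = (real k + a) * (real k + b) * ?c k * u ^ k"
      unfolding ring_coeff_Suc a_def b_def by simp
    finally show ?thesis by (simp add: algebra_simps)
  qed
  ultimately show ?thesis
    by (simp add: sums_iff mult.assoc)
qed

text \<open>Functions of the form D^(-r) \<omega>(4 S / D^2) are closed under both partial
  derivatives: r grows by 1 for D and by 2 for S, and \<omega> is replaced by an explicit
  combination. Applying the rule twice yields all the second derivatives defined below.\<close>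

lemma powr_comp_deriv:
  fixes D S \<omega> :: "real \<Rightarrow> real"
  assumes D: "(D has_real_derivative D') (at t within A)" and S: "(S has_real_derivative S') (at t within A)"
    and "D t > 0" and \<omega>: "(\<omega> has_real_derivative \<omega>') (at (4 * S t / (D t)\<^sup>2))"
  shows "((\<lambda>t. D t powr (- r) * \<omega> (4 * S t / (D t)\<^sup>2)) has_real_derivative
      D t powr (- (r + 1)) * (- r * \<omega> (4 * S t / (D t)\<^sup>2) - 2 * (4 * S t / (D t)\<^sup>2) * \<omega>') * D'
      + D t powr (- (r + 2)) * (4 * \<omega>') * S') (at t within A)"
proof -
  have p: "D t powr (- r) = D t * D t powr (- (r + 1))" "D t powr (- (r + 1)) = D t * D t powr (- (r + 2))"
    using \<open>D t > 0\<close> by (simp_all add: powr_mult_base algebra_simps)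
  have 1: "((\<lambda>t. D t powr (- r)) has_real_derivative (- r * D t powr (- r - 1)) * D') (at t within A)"
    by (rule DERIV_chain2[OF has_real_derivative_powr D]) fact
  have 2: "((\<lambda>t. 4 * S t / (D t)\<^sup>2) has_real_derivative (4 * S' / (D t)\<^sup>2 - 2 * (4 * S t / (D t)\<^sup>2) * D' / D t))
      (at t within A)"
    using \<open>D t > 0\<close>
    by (auto intro!: derivative_eq_intros D S simp: field_simps power2_eq_square power4_eq_xxxx)
  have 3: "((\<lambda>t. \<omega> (4 * S t / (D t)\<^sup>2)) has_real_derivative
      \<omega>' * (4 * S' / (D t)\<^sup>2 - 2 * (4 * S t / (D t)\<^sup>2) * D' / D t)) (at t within A)"
    by (rule DERIV_chain2[OF \<omega> 2])
  have r1: "- r - 1 = - (r + 1)" by simp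
  have "(- r * D t powr (- r - 1)) * D' * \<omega> (4 * S t / (D t)\<^sup>2)
      + (\<omega>' * (4 * S' / (D t)\<^sup>2 - 2 * (4 * S t / (D t)\<^sup>2) * D' / D t)) * D t powr (- r)
    = D t powr (- (r + 1)) * (- r * \<omega> (4 * S t / (D t)\<^sup>2) - 2 * (4 * S t / (D t)\<^sup>2) * \<omega>') * D'
      + D t powr (- (r + 2)) * (4 * \<omega>') * S'"
    unfolding r1 p using \<open>D t > 0\<close> by (simp add: field_simps power2_eq_square)
  with DERIV_mult[OF 1 3] show ?thesis by simp
qed

text \<open>Up to a constant and a power of \<open>S\<close>, \<open>kern m D S\<close> is the function \<open>Q\<^bsub>m-1/2\<^esub>(D / (2 \<surd>S))\<close>,
  in a form that is smooth at \<open>S = 0\<close>. The suffixes denote partial derivatives.\<close>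

definition kern :: "nat \<Rightarrow> real \<Rightarrow> real \<Rightarrow> real" where
  "kern m D S = D powr (- (real m + 1/2)) * power_sum (ring_coeff m) (4 * S / D\<^sup>2)"

definition kern_D :: "nat \<Rightarrow> real \<Rightarrow> real \<Rightarrow> real" where
  "kern_D m D S = D powr (- (real m + 1/2 + 1)) *
     (- (real m + 1/2) * power_sum (ring_coeff m) (4 * S / D\<^sup>2)
      - 2 * (4 * S / D\<^sup>2) * power_sum (diffs (ring_coeff m)) (4 * S / D\<^sup>2))"

definition kern_S :: "nat \<Rightarrow> real \<Rightarrow> real \<Rightarrow> real" where
  "kern_S m D S = D powr (- (real m + 1/2 + 2)) * (4 * power_sum (diffs (ring_coeff m)) (4 * S / D\<^sup>2))"

definition kern_DD :: "nat \<Rightarrow> real \<Rightarrow> real \<Rightarrow> real" where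
  "kern_DD m D S = D powr (- (real m + 1/2 + 1 + 1)) *
     (- (real m + 1/2 + 1) * (- (real m + 1/2) * power_sum (ring_coeff m) (4 * S / D\<^sup>2)
        - 2 * (4 * S / D\<^sup>2) * power_sum (diffs (ring_coeff m)) (4 * S / D\<^sup>2))
      - 2 * (4 * S / D\<^sup>2) * (- (real m + 1/2 + 2) * power_sum (diffs (ring_coeff m)) (4 * S / D\<^sup>2)
        - 2 * (4 * S / D\<^sup>2) * power_sum (diffs (diffs (ring_coeff m))) (4 * S / D\<^sup>2)))"

definition kern_DS :: "nat \<Rightarrow> real \<Rightarrow> real \<Rightarrow> real" where
  "kern_DS m D S = D powr (- (real m + 1/2 + 1 + 2)) *
     (4 * (- (real m + 1/2 + 2) * power_sum (diffs (ring_coeff m)) (4 * S / D\<^sup>2)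
        - 2 * (4 * S / D\<^sup>2) * power_sum (diffs (diffs (ring_coeff m))) (4 * S / D\<^sup>2)))"

definition kern_SS :: "nat \<Rightarrow> real \<Rightarrow> real \<Rightarrow> real" where
  "kern_SS m D S = D powr (- (real m + 1/2 + 2 + 2)) *
     (4 * (4 * power_sum (diffs (diffs (ring_coeff m))) (4 * S / D\<^sup>2)))"

section \<open>Calculus of the kernel in the variables D and S\<close>

definition kern_dom :: "real \<Rightarrow> real \<Rightarrow> bool" where
  "kern_dom D S \<longleftrightarrow> D > 0 \<and> 4 * \<bar>S\<bar> < D\<^sup>2"

lemma kern_dom_less_1: "kern_dom D S \<Longrightarrow> \<bar>4 * S / D\<^sup>2\<bar> < 1"
  by (simp add: kern_dom_def abs_mult)

lemma kern_derivs:
  assumes D: "(D has_real_derivative D') (at t within A)" and S: "(S has_real_derivative S') (at t within A)"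
    and dom: "kern_dom (D t) (S t)"
  shows "((\<lambda>t. kern m (D t) (S t)) has_real_derivative
           kern_D m (D t) (S t) * D' + kern_S m (D t) (S t) * S') (at t within A)"
    and "((\<lambda>t. kern_D m (D t) (S t)) has_real_derivative
           kern_DD m (D t) (S t) * D' + kern_DS m (D t) (S t) * S') (at t within A)"
    and "((\<lambda>t. kern_S m (D t) (S t)) has_real_derivative
           kern_DS m (D t) (S t) * D' + kern_SS m (D t) (S t) * S') (at t within A)"
proof -
  let ?u = "4 * S t / (D t)\<^sup>2"
  have "D t > 0" using dom by (simp add: kern_dom_def)
  note rule = powr_comp_deriv[OF D S this]
  note d = ring_series_deriv[OF kern_dom_less_1[OF dom], of m]
  show "((\<lambda>t. kern m (D t) (S t)) has_real_derivative
           kern_D m (D t) (S t) * D' + kern_S m (D t) (S t) * S') (at t within A)"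
    unfolding kern_def kern_D_def kern_S_def by (rule rule[OF d(1)])
  have "((\<lambda>u. - (real m + 1/2) * power_sum (ring_coeff m) u - 2 * u * power_sum (diffs (ring_coeff m)) u)
      has_real_derivative - (real m + 1/2 + 2) * power_sum (diffs (ring_coeff m)) ?u
        - 2 * ?u * power_sum (diffs (diffs (ring_coeff m))) ?u) (at ?u)"
    by (rule derivative_eq_intros d refl)+ (simp add: algebra_simps)
  from rule[OF this] show "((\<lambda>t. kern_D m (D t) (S t)) has_real_derivative
           kern_DD m (D t) (S t) * D' + kern_DS m (D t) (S t) * S') (at t within A)"
    unfolding kern_D_def kern_DD_def kern_DS_def .
  have "((\<lambda>u. 4 * power_sum (diffs (ring_coeff m)) u)
      has_real_derivative 4 * power_sum (diffs (diffs (ring_coeff m))) ?u) (at ?u)"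
    by (rule derivative_eq_intros d refl)+ simp
  note rule[OF this, of "real m + 1/2 + 2"]
  moreover have "D t powr (- (real m + 1/2 + 2 + 1)) *
        (- (real m + 1/2 + 2) * (4 * power_sum (diffs (ring_coeff m)) ?u)
         - 2 * ?u * (4 * power_sum (diffs (diffs (ring_coeff m))) ?u)) = kern_DS m (D t) (S t)"
    by (simp add: kern_DS_def algebra_simps)
  ultimately show "((\<lambda>t. kern_S m (D t) (S t)) has_real_derivative
           kern_DS m (D t) (S t) * D' + kern_SS m (D t) (S t) * S') (at t within A)"
    unfolding kern_S_def kern_SS_def by simp
qed

lemma kern_continuous_on:
  fixes D S :: "'a :: topological_space \<Rightarrow> real"
  assumes D: "continuous_on A D" and S: "continuous_on A S" and dom: "\<And>t. t \<in> A \<Longrightarrow> kern_dom (D t) (S t)"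
  shows "continuous_on A (\<lambda>t. kern m (D t) (S t))"
    and "continuous_on A (\<lambda>t. kern_D m (D t) (S t))"
    and "continuous_on A (\<lambda>t. kern_S m (D t) (S t))"
    and "continuous_on A (\<lambda>t. kern_DD m (D t) (S t))"
    and "continuous_on A (\<lambda>t. kern_DS m (D t) (S t))"
    and "continuous_on A (\<lambda>t. kern_SS m (D t) (S t))"
proof -
  have pos: "D t > 0" if "t \<in> A" for t
    using dom[OF that] by (simp add: kern_dom_def)
  have ne: "D t \<noteq> 0" if "t \<in> A" for t
    using pos[OF that] by simp
  have p: "continuous_on A (\<lambda>t. D t powr r)" for r
    by (intro continuous_intros D) (use ne in auto)
  have u: "continuous_on A (\<lambda>t. 4 * S t / (D t)\<^sup>2)"
    by (intro continuous_intros D S) (use ne in auto)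
  have comp: "continuous_on A (\<lambda>t. f (4 * S t / (D t)\<^sup>2))" if "\<And>u. \<bar>u\<bar> < 1 \<Longrightarrow> isCont f u" for f :: "real \<Rightarrow> real"
  proof (rule continuous_on_compose2[OF _ u])
    show "continuous_on {u. \<bar>u\<bar> < 1} f"
      using that by (intro continuous_at_imp_continuous_on) auto
    show "(\<lambda>t. 4 * S t / (D t)\<^sup>2) ` A \<subseteq> {u. \<bar>u\<bar> < 1}"
      using kern_dom_less_1[OF dom] by blast
  qed
  note c = comp[OF DERIV_isCont[OF ring_series_deriv(1)]] comp[OF DERIV_isCont[OF ring_series_deriv(2)]]
    comp[OF ring_series_deriv(3)]
  show "continuous_on A (\<lambda>t. kern m (D t) (S t))"
    and "continuous_on A (\<lambda>t. kern_D m (D t) (S t))"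
    and "continuous_on A (\<lambda>t. kern_S m (D t) (S t))"
    and "continuous_on A (\<lambda>t. kern_DD m (D t) (S t))"
    and "continuous_on A (\<lambda>t. kern_DS m (D t) (S t))"
    and "continuous_on A (\<lambda>t. kern_SS m (D t) (S t))"
    unfolding kern_def kern_D_def kern_S_def kern_DD_def kern_DS_def kern_SS_def
    by (intro continuous_on_mult continuous_on_diff continuous_on_const p u c; assumption)+
qed

text \<open>Euler's identity for \<open>kern_D\<close>, which is homogeneous of degree -(m + 3/2)
  when D has weight 1 and S has weight 2.\<close>

lemma kern_homogeneous:
  assumes "D > 0"
  shows "D * kern_DD m D S + 2 * S * kern_DS m D S = - (real m + 3/2) * kern_D m D S"
proof -
  have p: "D powr (- (real m + 1/2 + 1)) = D * D powr (- (real m + 1/2 + 1 + 1))"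
     "D powr (- (real m + 1/2 + 1 + 1)) = D * D powr (- (real m + 1/2 + 1 + 2))"
    using assms by (simp_all add: powr_mult_base)
  define q f0 f1 f2 where "q = D powr (- (real m + 1/2 + 1 + 2))" "f0 = power_sum (ring_coeff m) (4 * S / D\<^sup>2)"
    "f1 = power_sum (diffs (ring_coeff m)) (4 * S / D\<^sup>2)" "f2 = power_sum (diffs (diffs (ring_coeff m))) (4 * S / D\<^sup>2)"
  show ?thesis
    unfolding kern_DD_def kern_DS_def kern_D_def p q_f0_f1_f2_def[symmetric]
    using assms by (simp add: field_simps power2_eq_square)
qed

text \<open>This is \<open>ring_series_ode\<close> after the powers of D are factored out. In the
  variable s = 2 sqrt S it is the Euler-Poisson-Darboux equation.\<close>

lemma kern_pde:
  assumes "kern_dom D S"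
  shows "kern_DD m D S = S * kern_SS m D S + (real m + 1) * kern_S m D S"
proof -
  have D: "D > 0" using assms by (simp add: kern_dom_def)
  define q where "q = D powr (- (real m + 1/2 + 2))"
  define u where "u = 4 * S / D\<^sup>2"
  define f0 f1 f2 where "f0 = power_sum (ring_coeff m) u"
    "f1 = power_sum (diffs (ring_coeff m)) u" "f2 = power_sum (diffs (diffs (ring_coeff m))) u"
  have q2: "D powr (- (real m + 1/2 + 2 + 2)) = q / D\<^sup>2"
  proof -
    have "D powr (- (real m + 1/2 + 2 + 2)) = q * D powr (- 2)"
      unfolding q_def powr_add[symmetric] by (simp add: algebra_simps)
    then show ?thesis using D by (simp add: powr_minus_divide powr_numeral)
  qed
  have "u * f2 + (real m + 1) * f1
      = u\<^sup>2 * f2 + ((real m + 1/2) / 2 + (real m + 3/2) / 2 + 1) * u * f1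
        + (real m + 1/2) / 2 * ((real m + 3/2) / 2) * f0"
    unfolding f0_f1_f2_def by (rule ring_series_ode) (use kern_dom_less_1[OF assms] in \<open>simp add: u_def\<close>)
  then have "- (real m + 1/2 + 1) * (- (real m + 1/2) * f0 - 2 * u * f1)
      - 2 * u * (- (real m + 1/2 + 2) * f1 - 2 * u * f2) = 4 * (u * f2 + (real m + 1) * f1)"
    by (simp add: field_simps power2_eq_square)
  moreover have "kern_DD m D S = q * (- (real m + 1/2 + 1) * (- (real m + 1/2) * f0 - 2 * u * f1)
      - 2 * u * (- (real m + 1/2 + 2) * f1 - 2 * u * f2))"
    unfolding kern_DD_def u_def f0_f1_f2_def q_def by simp
  moreover have "S * kern_SS m D S + (real m + 1) * kern_S m D S = q * (4 * (u * f2 + (real m + 1) * f1))"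
    unfolding kern_SS_def kern_S_def q2 q_def[symmetric] u_def[symmetric] f0_f1_f2_def[symmetric]
    by (simp add: u_def algebra_simps)
  ultimately show ?thesis by simp
qed

subsection \<open>The symmetric kernel\<close>

text \<open>In terms of the cylindrical coordinates \<open>R = sinh \<sigma> sin \<theta>\<close>, \<open>z = cosh \<sigma> cos \<theta>\<close> of two points,
  \<open>ring_D = R\<^sup>2 + R'\<^sup>2 + (z - z')\<^sup>2\<close> and \<open>ring_S = R\<^sup>2R'\<^sup>2\<close>.\<close>

definition ring_D :: "real \<Rightarrow> real \<Rightarrow> real \<Rightarrow> real \<Rightarrow> real" where
  "ring_D u v c d = u\<^sup>2 + v\<^sup>2 + c\<^sup>2 + d\<^sup>2 - 2 - 2 * u * v * c * d"

definition ring_S :: "real \<Rightarrow> real \<Rightarrow> real \<Rightarrow> real \<Rightarrow> real" where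
  "ring_S u v c d = (1 - u\<^sup>2) * (1 - v\<^sup>2) * (1 - c\<^sup>2) * (1 - d\<^sup>2)"

definition ring_dom :: "real \<Rightarrow> real \<Rightarrow> real \<Rightarrow> real \<Rightarrow> bool" where
  "ring_dom u v c d \<longleftrightarrow> kern_dom (ring_D u v c d) (ring_S u v c d)"

definition ring_kernel :: "nat \<Rightarrow> real \<Rightarrow> real \<Rightarrow> real \<Rightarrow> real \<Rightarrow> real" where
  "ring_kernel m u v c d = kern m (ring_D u v c d) (ring_S u v c d)"

definition ring_u :: "nat \<Rightarrow> real \<Rightarrow> real \<Rightarrow> real \<Rightarrow> real \<Rightarrow> real" where
  "ring_u m u v c d = kern_D m (ring_D u v c d) (ring_S u v c d) * (2 * u - 2 * v * c * d)
     + kern_S m (ring_D u v c d) (ring_S u v c d) * (- 2 * u * (1 - v\<^sup>2) * (1 - c\<^sup>2) * (1 - d\<^sup>2))"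

definition ring_uu :: "nat \<Rightarrow> real \<Rightarrow> real \<Rightarrow> real \<Rightarrow> real \<Rightarrow> real" where
  "ring_uu m u v c d =
     kern_DD m (ring_D u v c d) (ring_S u v c d) * (2 * u - 2 * v * c * d)\<^sup>2
     + 2 * kern_DS m (ring_D u v c d) (ring_S u v c d) * (2 * u - 2 * v * c * d) * (- 2 * u * (1 - v\<^sup>2) * (1 - c\<^sup>2) * (1 - d\<^sup>2))
     + kern_SS m (ring_D u v c d) (ring_S u v c d) * (- 2 * u * (1 - v\<^sup>2) * (1 - c\<^sup>2) * (1 - d\<^sup>2))\<^sup>2
     + kern_D m (ring_D u v c d) (ring_S u v c d) * 2
     + kern_S m (ring_D u v c d) (ring_S u v c d) * (- 2 * (1 - v\<^sup>2) * (1 - c\<^sup>2) * (1 - d\<^sup>2))"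

lemma ring_swap:
  "ring_D u v c d = ring_D v u c d" "ring_S u v c d = ring_S v u c d"
  "ring_D u v c d = ring_D c v u d" "ring_S u v c d = ring_S c v u d"
  by (simp_all add: ring_D_def ring_S_def)

lemma ring_derivs:
  assumes "ring_dom u v c d"
  shows "((\<lambda>u. ring_kernel m u v c d) has_real_derivative ring_u m u v c d) (at u within A)"
    and "((\<lambda>u. ring_u m u v c d) has_real_derivative ring_uu m u v c d) (at u within A)"
proof -
  have D: "((\<lambda>u. ring_D u v c d) has_real_derivative 2 * u - 2 * v * c * d) (at u within A)"
    unfolding ring_D_def by (auto intro!: derivative_eq_intros)
  have S: "((\<lambda>u. ring_S u v c d) has_real_derivative - 2 * u * (1 - v\<^sup>2) * (1 - c\<^sup>2) * (1 - d\<^sup>2)) (at u within A)"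
    unfolding ring_S_def by (auto intro!: derivative_eq_intros)
  note d = kern_derivs[OF D S assms[unfolded ring_dom_def], of m]
  show "((\<lambda>u. ring_kernel m u v c d) has_real_derivative ring_u m u v c d) (at u within A)"
    unfolding ring_kernel_def ring_u_def by (rule d)
  show "((\<lambda>u. ring_u m u v c d) has_real_derivative ring_uu m u v c d) (at u within A)"
    unfolding ring_u_def ring_uu_def
    by (rule derivative_eq_intros d refl)+ (simp add: algebra_simps power2_eq_square)
qed

text \<open>By symmetry, \<open>ring_u m v u\<close> and \<open>ring_uu m v u\<close> are the derivatives with respect to \<open>v\<close>.\<close>
lemma ring_pde:
  assumes "ring_dom u v c d"
  shows "(1 - u\<^sup>2) * ring_uu m u v c d - 2 * (real m + 1) * u * ring_u m u v c d
       = (1 - v\<^sup>2) * ring_uu m v u c d - 2 * (real m + 1) * v * ring_u m v u c d"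
proof -
  define D S N where "D = ring_D u v c d" "S = ring_S u v c d" "N = (1 - c\<^sup>2) * (1 - d\<^sup>2)"
  define k where "k = c * d"
  define kD kS kDD kDS kSS where "kD = kern_D m D S" "kS = kern_S m D S"
    "kDD = kern_DD m D S" "kDS = kern_DS m D S" "kSS = kern_SS m D S"
  have sym: "ring_D v u c d = D" "ring_S v u c d = S"
    unfolding D_S_N_def by (rule ring_swap)+
  have S: "S = (1 - u\<^sup>2) * (1 - v\<^sup>2) * N"
    by (simp add: D_S_N_def ring_S_def)
  \<comment> \<open>\<open>D + N\<close> involves c and d only through their product
    \<open>k\<close>, so the comparison of \<open>Lu\<close> and \<open>Lv\<close> becomes a
    polynomial identity in u, v, \<open>k\<close>, \<open>N\<close> and the partial
    derivatives.\<close>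
  have DN: "D + N = 1 + k\<^sup>2 + (u\<^sup>2 - 1) + (v\<^sup>2 - 1) - 2 * u * v * k"
    by (simp add: D_S_N_def ring_D_def k_def algebra_simps power_mult_distrib)
  have "kern_dom D S" using assms by (simp add: ring_dom_def D_S_N_def)
  then have pde: "kDD = S * kSS + (real m + 1) * kS"
    unfolding kD_kS_kDD_kDS_kSS_def by (rule kern_pde)
  have hom: "D * kDD + 2 * S * kDS = - (real m + 3/2) * kD"
    unfolding kD_kS_kDD_kDS_kSS_def
    by (rule kern_homogeneous) (use \<open>kern_dom D S\<close> in \<open>simp add: kern_dom_def\<close>)
  define Lu where "Lu = (1 - u\<^sup>2) * (kDD * (2 * u - 2 * v * k)\<^sup>2 + 2 * kDS * (2 * u - 2 * v * k) * (- 2 * u * (1 - v\<^sup>2) * N)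
     + kSS * (- 2 * u * (1 - v\<^sup>2) * N)\<^sup>2 + kD * 2 + kS * (- 2 * (1 - v\<^sup>2) * N))
     - 2 * (real m + 1) * u * (kD * (2 * u - 2 * v * k) + kS * (- 2 * u * (1 - v\<^sup>2) * N))"
  define Lv where "Lv = (1 - v\<^sup>2) * (kDD * (2 * v - 2 * u * k)\<^sup>2 + 2 * kDS * (2 * v - 2 * u * k) * (- 2 * v * (1 - u\<^sup>2) * N)
     + kSS * (- 2 * v * (1 - u\<^sup>2) * N)\<^sup>2 + kD * 2 + kS * (- 2 * (1 - u\<^sup>2) * N))
     - 2 * (real m + 1) * v * (kD * (2 * v - 2 * u * k) + kS * (- 2 * v * (1 - u\<^sup>2) * N))"
  \<comment> \<open>The difference is divisible by u^2 - v^2. In the cofactor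
    \<open>kern_pde\<close> cancels the terms with \<open>N\<close>, and what remains is Euler's
    identity.\<close>
  have "Lu - Lv = 4 * (u\<^sup>2 - v\<^sup>2) * (- (D + N) * kDD - 2 * S * kDS - (real m + 3/2) * kD
      + N * (S * kSS + (real m + 1) * kS))"
    unfolding Lu_def Lv_def S DN by (simp add: algebra_simps power2_eq_square)
  also have "\<dots> = 4 * (u\<^sup>2 - v\<^sup>2) * (- (D * kDD + 2 * S * kDS) - (real m + 3/2) * kD)"
    unfolding pde[symmetric] by (simp add: algebra_simps)
  also have "\<dots> = 0"
    unfolding hom by (simp add: algebra_simps)
  finally have "Lu = Lv" by simp
  then show ?thesis
    unfolding Lu_def Lv_def ring_uu_def ring_u_def sym
    unfolding D_S_N_def[symmetric] kD_kS_kDD_kDS_kSS_def[symmetric]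
    by (simp add: D_S_N_def(3) k_def mult.assoc)
qed

lemma ring_dom_swap: "ring_dom u v c d \<longleftrightarrow> ring_dom v u c d"
  by (simp add: ring_dom_def ring_swap(1,2)[of u v])

lemma ring_continuous_on:
  fixes f g :: "'a :: topological_space \<Rightarrow> real"
  assumes "continuous_on A f" "continuous_on A g" "continuous_on A h" "continuous_on A k"
    and "\<And>t. t \<in> A \<Longrightarrow> ring_dom (f t) (g t) (h t) (k t)"
  shows "continuous_on A (\<lambda>t. ring_kernel m (f t) (g t) (h t) (k t))"
    and "continuous_on A (\<lambda>t. ring_u m (f t) (g t) (h t) (k t))"
    and "continuous_on A (\<lambda>t. ring_uu m (f t) (g t) (h t) (k t))"
proof -
  have "continuous_on A (\<lambda>t. ring_D (f t) (g t) (h t) (k t))" "continuous_on A (\<lambda>t. ring_S (f t) (g t) (h t) (k t))"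
    unfolding ring_D_def ring_S_def by (intro continuous_intros assms)+
  note c = kern_continuous_on[OF this, unfolded ring_dom_def[symmetric], OF assms(5)]
  show "continuous_on A (\<lambda>t. ring_kernel m (f t) (g t) (h t) (k t))"
    and "continuous_on A (\<lambda>t. ring_u m (f t) (g t) (h t) (k t))"
    and "continuous_on A (\<lambda>t. ring_uu m (f t) (g t) (h t) (k t))"
    unfolding ring_kernel_def ring_u_def ring_uu_def by (intro continuous_intros c assms(1-4); assumption)+
qed

text \<open>Lagrange's identity in x: the derivative of the weighted Wronskian \<open>B\<close>
  trades L acting on the kernel, which \<open>ring_pde\<close> moves from x to v, for the eigenvalue
  of p. The factor (1 - x^2)^(m+1) of \<open>B\<close> removes the boundary terms. The interval for
  v is left open because both [-1, 1], for y, and [1, \<xi>] are needed.\<close>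

lemma ring_integral_ode:
  fixes m n :: nat and a b c d :: real
  defines "w \<equiv> (\<lambda>x. (1 - x\<^sup>2) ^ m * poly (dlegendre m n) x)"
  defines "F \<equiv> (\<lambda>v. integral {-1..1} (\<lambda>x. w x * ring_kernel m v x c d))"
    and "F1 \<equiv> (\<lambda>v. integral {-1..1} (\<lambda>x. w x * ring_u m v x c d))"
    and "F2 \<equiv> (\<lambda>v. integral {-1..1} (\<lambda>x. w x * ring_uu m v x c d))"
  assumes dom: "\<And>v x. v \<in> {a..b} \<Longrightarrow> x \<in> {-1..1} \<Longrightarrow> ring_dom v x c d" and v: "v \<in> {a..b}"
  shows "(F has_real_derivative F1 v) (at v within {a..b})"
    and "(F1 has_real_derivative F2 v) (at v within {a..b})"
    and "(1 - v\<^sup>2) * F2 v - 2 * (real m + 1) * v * F1 v = - ((real n - real m) * (real n + real m + 1)) * F v"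
proof -
  have w: "continuous_on A (\<lambda>t. w (f t))" if "continuous_on A f" for A and f :: "'z::topological_space \<Rightarrow> real"
    unfolding w_def by (intro continuous_intros that)
  have c1: "continuous_on {-1..1} (\<lambda>x. w x * ring_kernel m v x c d)" 
    and c2: "continuous_on {-1..1} (\<lambda>x. w x * ring_u m v x c d)"
    and c3: "continuous_on {-1..1} (\<lambda>x. w x * ring_uu m v x c d)" if "v \<in> {a..b}" for v
    by (intro continuous_on_mult w ring_continuous_on continuous_on_const continuous_on_id dom that; assumption)+
  have j: "continuous_on ({a..b} \<times> {-1..1}) (\<lambda>z. w (snd z) * ring_u m (fst z) (snd z) c d)"
     "continuous_on ({a..b} \<times> {-1..1}) (\<lambda>z. w (snd z) * ring_uu m (fst z) (snd z) c d)"
    by (intro continuous_on_mult w ring_continuous_on continuous_on_const continuous_on_fst continuous_on_snd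
        continuous_on_id; auto intro: dom)+
  show "(F has_real_derivative F1 v) (at v within {a..b})"
    unfolding F_def F1_def cbox_interval[symmetric]
  proof (rule leibniz_rule_field_derivative)
    show "((\<lambda>v. w x * ring_kernel m v x c d) has_real_derivative w x * ring_u m v x c d) (at v within cbox a b)"
      if "v \<in> cbox a b" "x \<in> cbox (-1) 1" for v x
      using that by (intro DERIV_cmult ring_derivs dom) auto
    show "(\<lambda>x. w x * ring_kernel m v x c d) integrable_on cbox (-1) 1" if "v \<in> cbox a b" for v
      using c1[of v] that by (auto intro!: integrable_continuous_real)
    show "continuous_on (cbox a b \<times> cbox (-1) 1) (\<lambda>(v, x). w x * ring_u m v x c d)"
      using j(1) by (simp add: case_prod_unfold)
  qed (use v in auto)
  show "(F1 has_real_derivative F2 v) (at v within {a..b})"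
    unfolding F1_def F2_def cbox_interval[symmetric]
  proof (rule leibniz_rule_field_derivative)
    show "((\<lambda>v. w x * ring_u m v x c d) has_real_derivative w x * ring_uu m v x c d) (at v within cbox a b)"
      if "v \<in> cbox a b" "x \<in> cbox (-1) 1" for v x
      using that by (intro DERIV_cmult ring_derivs dom) auto
    show "(\<lambda>x. w x * ring_u m v x c d) integrable_on cbox (-1) 1" if "v \<in> cbox a b" for v
      using c2[of v] that by (auto intro!: integrable_continuous_real)
    show "continuous_on (cbox a b \<times> cbox (-1) 1) (\<lambda>(v, x). w x * ring_uu m v x c d)"
      using j(2) by (simp add: case_prod_unfold)
  qed (use v in auto)
  let ?ev = "(real n - real m) * (real n + real m + 1)"
  let ?p = "poly (dlegendre m n)" and ?p1 = "poly (dlegendre (Suc m) n)" and ?p2 = "poly (dlegendre (Suc (Suc m)) n)"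
  define B where "B x = (1 - x\<^sup>2) ^ Suc m * (?p x * ring_u m x v c d - ?p1 x * ring_kernel m x v c d)" for x
  have I: "(\<lambda>x. w x * ring_kernel m v x c d) integrable_on {-1..1}" "(\<lambda>x. w x * ring_u m v x c d) integrable_on {-1..1}"
    "(\<lambda>x. w x * ring_uu m v x c d) integrable_on {-1..1}"
    by (intro integrable_continuous_real c1 c2 c3 v)+
  have "(B has_real_derivative (1 - v\<^sup>2) * (w x * ring_uu m v x c d) - 2 * (real m + 1) * v * (w x * ring_u m v x c d)
      + ?ev * (w x * ring_kernel m v x c d)) (at x within {-1..1})" if x: "x \<in> {-1..1}" for x
  proof -
    have dx: "ring_dom x v c d" using dom[OF v x] ring_dom_swap by blast
    have "(B has_real_derivative (1 - x\<^sup>2) ^ m * (?p x * ((1 - x\<^sup>2) * ring_uu m x v c d - 2 * (real m + 1) * x * ring_u m x v c d)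
       - ((1 - x\<^sup>2) * ?p2 x - 2 * (real m + 1) * x * ?p1 x) * ring_kernel m x v c d)) (at x within {-1..1})"
      unfolding B_def
      by (rule derivative_eq_intros ring_derivs[OF dx] refl poly_DERIV[THEN has_field_derivative_at_within])+
         (simp add: algebra_simps)
    also have "(1 - x\<^sup>2) ^ m * (?p x * ((1 - x\<^sup>2) * ring_uu m x v c d - 2 * (real m + 1) * x * ring_u m x v c d)
       - ((1 - x\<^sup>2) * ?p2 x - 2 * (real m + 1) * x * ?p1 x) * ring_kernel m x v c d)
       = (1 - v\<^sup>2) * (w x * ring_uu m v x c d) - 2 * (real m + 1) * v * (w x * ring_u m v x c d)
      + ?ev * (w x * ring_kernel m v x c d)"
    proof -
      have r: "ring_kernel m x v c d = ring_kernel m v x c d"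
        unfolding ring_kernel_def by (simp only: ring_swap(1,2)[of x v])
      show ?thesis
        unfolding ring_pde[OF dx] dlegendre_ode r w_def by (simp add: algebra_simps)
    qed
    finally show ?thesis .
  qed
  then have int0: "((\<lambda>x. (1 - v\<^sup>2) * (w x * ring_uu m v x c d) - 2 * (real m + 1) * v * (w x * ring_u m v x c d)
      + ?ev * (w x * ring_kernel m v x c d)) has_integral (B 1 - B (-1))) {-1..1}"
    by (intro fundamental_theorem_of_calculus) (auto simp: has_real_derivative_iff_has_vector_derivative)
  have "((\<lambda>x. (1 - v\<^sup>2) * (w x * ring_uu m v x c d) - 2 * (real m + 1) * v * (w x * ring_u m v x c d)
      + ?ev * (w x * ring_kernel m v x c d)) has_integral
      ((1 - v\<^sup>2) * F2 v - 2 * (real m + 1) * v * F1 v + ?ev * F v)) {-1..1}"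
    unfolding F_def F1_def F2_def
    by (intro has_integral_add has_integral_diff has_integral_mult_right integrable_integral I)
  from has_integral_unique[OF this int0]
  have "(1 - v\<^sup>2) * F2 v - 2 * (real m + 1) * v * F1 v + ?ev * F v = 0"
    by (simp add: B_def)
  then show "(1 - v\<^sup>2) * F2 v - 2 * (real m + 1) * v * F1 v = - ?ev * F v"
    unfolding mult_minus_left by (rule eq_neg_iff_add_eq_0[THEN iffD2])
qed

subsection \<open>Regular solutions of the Legendre-type equation\<close>

text \<open>1 is a singular point, so a single value there suffices for uniqueness. Regularity
  enters through \<open>H1\<close> being continuous up to 1: the term (1 - t^2) \<open>H1\<close>^2
  of the energy vanishes there. The energy is nondecreasing on [0, 1] and ends at 0, hence is never
  positive.\<close>

lemma regular_ode_solution_eq_0: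
  fixes H H1 H2 :: "real \<Rightarrow> real" and ev :: real and m :: nat
  assumes H: "\<And>t. t \<in> {-1..1} \<Longrightarrow> (H has_real_derivative H1 t) (at t within {-1..1})"
    and H1: "\<And>t. t \<in> {-1..1} \<Longrightarrow> (H1 has_real_derivative H2 t) (at t within {-1..1})"
    and ode: "\<And>t. t \<in> {-1..1} \<Longrightarrow> (1 - t\<^sup>2) * H2 t - 2 * (real m + 1) * t * H1 t = - ev * H t"
    and ev: "ev \<ge> 0" and H_1: "H 1 = 0" and t: "t \<in> {-1..1}"
  shows "H t = 0"
proof -
  have dH: "(H has_real_derivative H1 t) (at t)" "(H1 has_real_derivative H2 t) (at t)" if "-1 < t" "t < 1" for t
    using H[of t] H1[of t] that by (auto simp: at_within_Icc_at)
  have cont: "continuous_on {-1..1} H" "continuous_on {-1..1} H1"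
    by (rule DERIV_continuous_on[OF H] DERIV_continuous_on[OF H1], assumption)+
  have sq1: "1 - t\<^sup>2 > 0" if "-1 < t" "t < 1" for t :: real
    using that by (simp add: abs_square_less_1 abs_less_iff)
  \<comment> \<open>For n = m the eigenvalue is 0 and the energy says nothing about
    \<open>H\<close>. Hence only \<open>H1\<close> = 0 is extracted, and \<open>H\<close> is
    recovered as a constant.\<close>
  have zero: "H1 t = 0"
    if "E \<le> 0" "E = a * (H1 t)\<^sup>2 + ev * (b * (H t)\<^sup>2)" "a > 0" "b \<ge> 0" for E a b t
  proof -
    have "a * (H1 t)\<^sup>2 \<ge> 0" "ev * (b * (H t)\<^sup>2) \<ge> 0"
      using that ev by simp_all
    with that have "a * (H1 t)\<^sup>2 = 0" by linarith
    with \<open>a > 0\<close> show ?thesis by simp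
  qed

  define E where "E t = (1 - t\<^sup>2) * (H1 t)\<^sup>2 + ev * (1 * (H t)\<^sup>2)" for t
  have E: "E t \<le> 0" if t: "0 \<le> t" "t \<le> 1" for t
  proof -
    have "E t \<le> E 1"
    proof (rule DERIV_nonneg_imp_increasing_open[OF t(2)])
      fix s assume s: "t < s" "s < 1"
      have "(E has_real_derivative 2 * H1 s * ((1 - s\<^sup>2) * H2 s) - 2 * s * (H1 s)\<^sup>2 + 2 * ev * H s * H1 s) (at s)"
        unfolding E_def using s t
        by (auto intro!: derivative_eq_intros dH simp: algebra_simps power2_eq_square)
      also have "(1 - s\<^sup>2) * H2 s = 2 * (real m + 1) * s * H1 s - ev * H s"
        using ode[of s] s t by simp
      also have "2 * H1 s * (2 * (real m + 1) * s * H1 s - ev * H s) - 2 * s * (H1 s)\<^sup>2 + 2 * ev * H s * H1 s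
          = (4 * real m + 2) * s * (H1 s)\<^sup>2"
        by (simp add: algebra_simps power2_eq_square)
      finally show "\<exists>y. (E has_real_derivative y) (at s) \<and> 0 \<le> y"
        using s t by (intro exI[of _ "(4 * real m + 2) * s * (H1 s)\<^sup>2"]) simp
    next
      show "continuous_on {t..1} E"
        unfolding E_def using t
        by (intro continuous_intros continuous_on_subset[OF cont(1)] continuous_on_subset[OF cont(2)]) auto
    qed
    then show ?thesis by (simp add: E_def H_1)
  qed
  have H1_pos: "H1 t = 0" if "0 \<le> t" "t < 1" for t
    using zero[OF E E_def] sq1[of t] that by simp
  have H_pos: "H t = 0" if t: "0 \<le> t" "t \<le> 1" for t
  proof (cases "t = 1")
    case False
    with t have "t < 1" by simp
    then have "H 1 = H t"
    proof (rule DERIV_isconst_end)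
      show "continuous_on {t..1} H"
        by (rule continuous_on_subset[OF cont(1)]) (use t in auto)
      show "(H has_real_derivative 0) (at s)" if "t < s" "s < 1" for s
        using dH(1)[of s] H1_pos[of s] that t by simp
    qed
    then show ?thesis by (simp add: H_1)
  qed (simp add: H_1)

  text \<open>For negative \<open>t\<close> the energy need not be monotone, but \<open>(1 - t\<^sup>2)\<^bsup>2m+1\<^esup>\<close> times it is.\<close>
  define K where "K t = (1 - t\<^sup>2) ^ (2 * m + 2) * (H1 t)\<^sup>2 + ev * ((1 - t\<^sup>2) ^ (2 * m + 1) * (H t)\<^sup>2)" for t
  have K: "K t \<le> 0" if t: "-1 \<le> t" "t \<le> 0" for t
  proof -
    have "K t \<le> K 0"
    proof (rule DERIV_nonneg_imp_increasing_open[OF t(2)])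
      fix s assume s: "t < s" "s < 0"
      define r where "r = 1 - s\<^sup>2"
      have "((\<lambda>t. (1 - t\<^sup>2) ^ Suc (2 * m + 1) * (H1 t)\<^sup>2 + ev * ((1 - t\<^sup>2) ^ Suc (2 * m) * (H t)\<^sup>2)) has_real_derivative
          - (4 * real m + 4) * s * r ^ Suc (2 * m) * (H1 s)\<^sup>2 + 2 * r ^ Suc (2 * m) * H1 s * (r * H2 s)
          + ev * (- (4 * real m + 2) * s * r ^ (2 * m) * (H s)\<^sup>2 + 2 * r ^ Suc (2 * m) * H s * H1 s)) (at s)"
        using s t
        by (auto intro!: derivative_eq_intros dH simp: r_def simp del: power_Suc)
           (simp add: algebra_simps)
      also have "(\<lambda>t. (1 - t\<^sup>2) ^ Suc (2 * m + 1) * (H1 t)\<^sup>2 + ev * ((1 - t\<^sup>2) ^ Suc (2 * m) * (H t)\<^sup>2)) = K"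
        by (simp add: K_def fun_eq_iff)
      also have "r * H2 s = 2 * (real m + 1) * s * H1 s - ev * H s"
        using ode[of s] s t by (simp add: r_def)
      also have "- (4 * real m + 4) * s * r ^ Suc (2 * m) * (H1 s)\<^sup>2
            + 2 * r ^ Suc (2 * m) * H1 s * (2 * (real m + 1) * s * H1 s - ev * H s)
          + ev * (- (4 * real m + 2) * s * r ^ (2 * m) * (H s)\<^sup>2 + 2 * r ^ Suc (2 * m) * H s * H1 s)
          = (4 * real m + 2) * (- s) * (ev * r ^ (2 * m) * (H s)\<^sup>2)"
        by (simp add: algebra_simps power2_eq_square)
      finally show "\<exists>y. (K has_real_derivative y) (at s) \<and> 0 \<le> y"
        using s t ev
        by (intro exI[of _ "(4 * real m + 2) * (- s) * (ev * r ^ (2 * m) * (H s)\<^sup>2)"] conjI mult_nonneg_nonneg)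
           (auto simp: power_mult)
    next
      show "continuous_on {t..0} K"
        unfolding K_def using t
        by (intro continuous_intros continuous_on_subset[OF cont(1)] continuous_on_subset[OF cont(2)]) auto
    qed
    then show ?thesis using H1_pos[of 0] H_pos[of 0] by (simp add: K_def)
  qed
  have H1_neg: "H1 t = 0" if "-1 < t" "t \<le> 0" for t
    by (rule zero[OF K K_def]) (use sq1[of t] that in auto)
  show ?thesis
  proof (cases "t < 0")
    case True
    have "H 0 = H t"
    proof (rule DERIV_isconst_end[OF True])
      show "continuous_on {t..0} H"
        by (rule continuous_on_subset[OF cont(1)]) (use t in auto)
      show "(H has_real_derivative 0) (at s)" if "t < s" "s < 0" for s
        using dH(1)[of s] H1_neg[of s] that t by simp
    qed
    then show ?thesis using H_pos[of 0] by simp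
  qed (use H_pos t in auto)
qed

text \<open>p has no zero on [1, b], so division is possible. The Wronskian times (1 - t^2)^(m+1) is
  constant and vanishes at 1 because of that factor, so f / p has derivative 0.\<close>

lemma regular_ode_solution_proportional:
  fixes f f1 f2 :: "real \<Rightarrow> real" and m n :: nat
  defines "p \<equiv> poly (dlegendre m n)"
  assumes f: "\<And>t. t \<in> {1..b} \<Longrightarrow> (f has_real_derivative f1 t) (at t within {1..b})"
    and f1: "\<And>t. t \<in> {1..b} \<Longrightarrow> (f1 has_real_derivative f2 t) (at t within {1..b})"
    and ode: "\<And>t. t \<in> {1..b} \<Longrightarrow> (1 - t\<^sup>2) * f2 t - 2 * (real m + 1) * t * f1 t
                = - ((real n - real m) * (real n + real m + 1)) * f t"
    and "m \<le> n" and b: "1 < b"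
  shows "f b * p 1 = f 1 * p b"
proof -
  let ?p1 = "poly (dlegendre (Suc m) n)" and ?p2 = "poly (dlegendre (Suc (Suc m)) n)"
  have df: "(f has_real_derivative f1 t) (at t)" "(f1 has_real_derivative f2 t) (at t)" if "1 < t" "t < b" for t
    using f[of t] f1[of t] that by (auto simp: at_within_Icc_at)
  have cont: "continuous_on {1..b} f" "continuous_on {1..b} f1"
    by (rule DERIV_continuous_on[OF f] DERIV_continuous_on[OF f1], assumption)+
  have dp: "(p has_real_derivative ?p1 t) (at t)" "(?p1 has_real_derivative ?p2 t) (at t)" for t
    unfolding p_def using poly_DERIV[of "dlegendre m n" t] poly_DERIV[of "dlegendre (Suc m) n" t] by simp_all
  have p_pos: "p t > 0" if "t \<ge> 1" for t
    unfolding p_def using that \<open>m \<le> n\<close> by (rule dlegendre_pos[rotated])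
  define W where "W t = (1 - t\<^sup>2) ^ Suc m * (f t * ?p1 t - f1 t * p t)" for t
  have dW: "(W has_real_derivative 0) (at t)" if t: "1 < t" "t < b" for t
  proof -
    have "(W has_real_derivative (1 - t\<^sup>2) ^ m * (f t * ((1 - t\<^sup>2) * ?p2 t - 2 * (real m + 1) * t * ?p1 t)
        - ((1 - t\<^sup>2) * f2 t - 2 * (real m + 1) * t * f1 t) * p t)) (at t)"
      unfolding W_def
      by (rule derivative_eq_intros df[OF t] dp refl)+ (simp add: algebra_simps)
    also have "(1 - t\<^sup>2) ^ m * (f t * ((1 - t\<^sup>2) * ?p2 t - 2 * (real m + 1) * t * ?p1 t)
        - ((1 - t\<^sup>2) * f2 t - 2 * (real m + 1) * t * f1 t) * p t) = 0"
      unfolding dlegendre_ode using ode[of t] t by (simp add: p_def)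
    finally show ?thesis .
  qed
  have W0: "W t = 0" if t: "1 < t" "t < b" for t
  proof -
    have "W t = W 1"
    proof (rule DERIV_isconst_end[OF t(1)])
      show "continuous_on {1..t} W"
        unfolding W_def p_def using t
        by (intro continuous_intros continuous_on_subset[OF cont(1)] continuous_on_subset[OF cont(2)]) auto
    qed (use dW t in auto)
    then show ?thesis by (simp add: W_def)
  qed
  have "f b / p b = f 1 / p 1"
  proof (rule DERIV_isconst_end[OF b])
    show "continuous_on {1..b} (\<lambda>t. f t / p t)"
      unfolding p_def by (intro continuous_intros cont) (use p_pos p_def in force)
    show "((\<lambda>t. f t / p t) has_real_derivative 0) (at t)" if t: "1 < t" "t < b" for t
    proof -
      have "1 - t\<^sup>2 \<noteq> 0" using t by (simp add: power2_eq_1_iff)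
      then have "f t * ?p1 t = f1 t * p t" using W0[OF t] by (simp add: W_def)
      then show ?thesis
        using p_pos[of t] t by (auto intro!: derivative_eq_intros df dp)
    qed
  qed
  with p_pos[of 1] p_pos[of b] b show ?thesis by (simp add: field_simps)
qed

text \<open>The two points lie on distinct confocal ellipses, the inner one degenerate for \<xi> =
  1. \<open>A\<close> and \<open>B\<close> are their squared distances from the axis and
  \<open>C\<close> is the difference of their heights; D^2 = 4 S would force the points to
  coincide.\<close>

lemma ring_dom_ellipses:
  assumes "1 \<le> \<xi>" "\<xi> < \<eta>" "x \<in> {-1..1}" "y \<in> {-1..1}"
  shows "ring_dom y x \<xi> \<eta>"
proof -
  define A B C where "A = (\<xi>\<^sup>2 - 1) * (1 - x\<^sup>2)" "B = (\<eta>\<^sup>2 - 1) * (1 - y\<^sup>2)" "C = \<xi> * x - \<eta> * y"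
  have xy: "x\<^sup>2 \<le> 1" "y\<^sup>2 \<le> 1"
    using assms by (auto simp: abs_square_le_1)
  have \<xi>\<eta>: "1 \<le> \<xi>\<^sup>2" "\<xi>\<^sup>2 < \<eta>\<^sup>2"
    using assms by (auto intro: power_strict_mono)
  have A: "A \<ge> 0" and B: "B \<ge> 0"
    using xy \<xi>\<eta> by (auto simp: A_B_C_def)
  have D: "ring_D y x \<xi> \<eta> = A + B + C\<^sup>2"
    by (simp add: A_B_C_def ring_D_def algebra_simps power2_eq_square)
  have S: "ring_S y x \<xi> \<eta> = A * B"
    by (simp add: A_B_C_def ring_S_def algebra_simps)
  have ne: "\<not> (A = B \<and> C = 0)"
  proof
    assume *: "A = B \<and> C = 0"
    then have 1: "\<xi>\<^sup>2 * x\<^sup>2 = \<eta>\<^sup>2 * y\<^sup>2"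
      by (simp add: A_B_C_def flip: power_mult_distrib)
    have 2: "x\<^sup>2 = \<eta>\<^sup>2 - \<xi>\<^sup>2 + y\<^sup>2"
      using * 1 by (simp add: A_B_C_def algebra_simps)
    have "(\<eta>\<^sup>2 - \<xi>\<^sup>2) * (\<xi>\<^sup>2 - y\<^sup>2) = 0"
      using 1 unfolding 2 by (simp add: algebra_simps)
    with \<xi>\<eta> have "\<xi>\<^sup>2 = y\<^sup>2" by simp
    with 2 xy \<xi>\<eta> show False by simp
  qed
  have "(A + B + C\<^sup>2)\<^sup>2 - 4 * (A * B) = (A - B)\<^sup>2 + 2 * (A + B) * C\<^sup>2 + (C\<^sup>2)\<^sup>2"
    by (simp add: algebra_simps power2_eq_square)
  moreover have "\<dots> > 0"
  proof (cases "C = 0")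
    case True
    with ne show ?thesis by simp
  next
    case False
    then have "(C\<^sup>2)\<^sup>2 > 0" "2 * (A + B) * C\<^sup>2 \<ge> 0" using A B by simp_all
    then show ?thesis by (smt (verit) zero_le_power2)
  qed
  moreover have "A + B + C\<^sup>2 > 0"
  proof (cases "C = 0")
    case True
    with ne A B show ?thesis by force
  next
    case False
    then have "C\<^sup>2 > 0" by simp
    with A B show ?thesis by linarith
  qed
  ultimately show ?thesis
    using A B by (simp add: ring_dom_def kern_dom_def D S)
qed

lemma ring_integral_factorizes:
  fixes m n :: nat and y \<xi> \<eta> :: real
  defines "p \<equiv> poly (dlegendre m n)"
  defines "I \<equiv> (\<lambda>y \<xi>. integral {-1..1} (\<lambda>x. (1 - x\<^sup>2) ^ m * p x * ring_kernel m y x \<xi> \<eta>))"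
  assumes "m \<le> n" "1 \<le> \<xi>" "\<xi> < \<eta>" "y \<in> {-1..1}"
  shows "I y \<xi> * (p 1)\<^sup>2 = p y * p \<xi> * I 1 1"
proof -
  let ?ev = "(real n - real m) * (real n + real m + 1)"
  \<comment> \<open>First y is moved to 1 with \<xi> fixed: this difference vanishes at y = 1 by
    construction and satisfies the equation of p.\<close>
  have "I y \<xi> * p 1 - I 1 \<xi> * p y = 0"
  proof -
    note d = ring_integral_ode[where m = m and n = n and a = "-1" and b = 1 and c = \<xi> and d = \<eta>,
        OF ring_dom_ellipses, OF assms(4,5)]
    have dp: "(poly (dlegendre k n) has_real_derivative poly (dlegendre (Suc k) n) t) (at t within A)" for k t A
      using poly_DERIV[of "dlegendre k n" t] by (auto intro: has_field_derivative_at_within)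
    show ?thesis
    proof (rule regular_ode_solution_eq_0[where ev = ?ev and m = m and t = y
          and H = "\<lambda>y. I y \<xi> * p 1 - I 1 \<xi> * p y"
          and ?H1.0 = "\<lambda>t. integral {-1..1} (\<lambda>x. (1 - x\<^sup>2) ^ m * p x * ring_u m t x \<xi> \<eta>) * p 1
            - I 1 \<xi> * poly (dlegendre (Suc m) n) t"
          and ?H2.0 = "\<lambda>t. integral {-1..1} (\<lambda>x. (1 - x\<^sup>2) ^ m * p x * ring_uu m t x \<xi> \<eta>) * p 1
            - I 1 \<xi> * poly (dlegendre (Suc (Suc m)) n) t"])
      fix t :: real assume t: "t \<in> {-1..1}"
      show "((\<lambda>y. I y \<xi> * p 1 - I 1 \<xi> * p y) has_real_derivative
          integral {-1..1} (\<lambda>x. (1 - x\<^sup>2) ^ m * p x * ring_u m t x \<xi> \<eta>) * p 1 - I 1 \<xi> * poly (dlegendre (Suc m) n) t)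
          (at t within {-1..1})"
        unfolding I_def p_def using t
        by (intro DERIV_diff DERIV_cmult DERIV_cmult_right d(1) dp) auto
      show "((\<lambda>t. integral {-1..1} (\<lambda>x. (1 - x\<^sup>2) ^ m * p x * ring_u m t x \<xi> \<eta>) * p 1
            - I 1 \<xi> * poly (dlegendre (Suc m) n) t) has_real_derivative
          integral {-1..1} (\<lambda>x. (1 - x\<^sup>2) ^ m * p x * ring_uu m t x \<xi> \<eta>) * p 1 - I 1 \<xi> * poly (dlegendre (Suc (Suc m)) n) t)
          (at t within {-1..1})"
        unfolding I_def p_def using t
        by (intro DERIV_diff DERIV_cmult DERIV_cmult_right d(2) dp) auto
      have ode: "(1 - t\<^sup>2) * integral {-1..1} (\<lambda>x. (1 - x\<^sup>2) ^ m * p x * ring_uu m t x \<xi> \<eta>)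
          - 2 * (real m + 1) * t * integral {-1..1} (\<lambda>x. (1 - x\<^sup>2) ^ m * p x * ring_u m t x \<xi> \<eta>) = - ?ev * I t \<xi>"
        unfolding I_def p_def using t by (intro d(3)) auto
      have gen: "(1 - t\<^sup>2) * (J2 * P1 - i1 * q2) - 2 * (real m + 1) * t * (J1 * P1 - i1 * q1)
          = ((1 - t\<^sup>2) * J2 - 2 * (real m + 1) * t * J1) * P1 - i1 * ((1 - t\<^sup>2) * q2 - 2 * (real m + 1) * t * q1)"
        for J1 J2 P1 i1 q1 q2 :: real
        by (simp add: algebra_simps)
      show "(1 - t\<^sup>2) * (integral {-1..1} (\<lambda>x. (1 - x\<^sup>2) ^ m * p x * ring_uu m t x \<xi> \<eta>) * p 1
            - I 1 \<xi> * poly (dlegendre (Suc (Suc m)) n) t)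
          - 2 * (real m + 1) * t * (integral {-1..1} (\<lambda>x. (1 - x\<^sup>2) ^ m * p x * ring_u m t x \<xi> \<eta>) * p 1
            - I 1 \<xi> * poly (dlegendre (Suc m) n) t)
          = - ?ev * (I t \<xi> * p 1 - I 1 \<xi> * p t)"
        unfolding gen ode dlegendre_ode p_def[symmetric] by (simp add: algebra_simps)
    qed (use assms in auto)
  qed
  moreover have "I 1 \<xi> * p 1 = I 1 1 * p \<xi>"
  proof (cases "\<xi> = 1")
    case False
    \<comment> \<open>With y = 1 reached, \<xi> is moved to 1. Exchanging the first and third
      arguments of the kernel puts \<xi> into the position that \<open>ring_integral_ode\<close>
      differentiates.\<close>
    have sw: "ring_kernel m 1 x t \<eta> = ring_kernel m t x 1 \<eta>" for x t
      unfolding ring_kernel_def by (simp only: ring_swap(3,4)[of 1 x t])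
    have dom: "ring_dom t x 1 \<eta>" if "t \<in> {1..\<xi>}" "x \<in> {-1..1}" for t x
      using ring_dom_ellipses[of t \<eta> x 1] that assms
      unfolding ring_dom_def ring_swap(3,4)[of 1 x t] by auto
    note d = ring_integral_ode[where m = m and n = n and a = 1 and b = \<xi> and c = 1 and d = \<eta>, OF dom]
    have I1: "I 1 t = integral {-1..1} (\<lambda>x. (1 - x\<^sup>2) ^ m * poly (dlegendre m n) x * ring_kernel m t x 1 \<eta>)" for t
      by (simp only: I_def sw p_def)
    show ?thesis
      unfolding I1 p_def
    proof (rule regular_ode_solution_proportional[where m = m and n = n and b = \<xi>
          and f = "\<lambda>t. integral {-1..1} (\<lambda>x. (1 - x\<^sup>2) ^ m * poly (dlegendre m n) x * ring_kernel m t x 1 \<eta>)"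
          and ?f1.0 = "\<lambda>t. integral {-1..1} (\<lambda>x. (1 - x\<^sup>2) ^ m * poly (dlegendre m n) x * ring_u m t x 1 \<eta>)"
          and ?f2.0 = "\<lambda>t. integral {-1..1} (\<lambda>x. (1 - x\<^sup>2) ^ m * poly (dlegendre m n) x * ring_uu m t x 1 \<eta>)"])
      show "1 < \<xi>" using assms False by simp
    qed ((rule d; assumption) | rule \<open>m \<le> n\<close>)+
  qed simp
  ultimately show ?thesis
    by (simp add: power2_eq_square algebra_simps)
qed

subsection \<open>Neumann's integral for the Legendre function of the second kind\<close>

text \<open>Each integration by parts moves one derivative onto the power of \<eta> - x. The
  boundary terms vanish since derivatives of order below n are 0 at both ends.\<close>

lemma integral_rodrigues_by_parts:
  fixes \<eta> :: real
  assumes "j \<le> n" "1 < \<eta>"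
  shows "integral {-1..1} (\<lambda>x. poly (rodrigues n j) x / (\<eta> - x) ^ Suc N)
       = (-1) ^ j * pochhammer (real N + 1) j * integral {-1..1} (\<lambda>x. (x\<^sup>2 - 1) ^ n / (\<eta> - x) ^ Suc (N + j))"
  using assms
proof (induction j arbitrary: N)
  case 0
  have "poly (rodrigues n 0) x = (x\<^sup>2 - 1) ^ n" for x
    by (simp add: rodrigues_def power2_eq_square)
  then show ?case by simp
next
  case (Suc j)
  let ?f = "\<lambda>x. poly (rodrigues n j) x / (\<eta> - x) ^ Suc N"
  have cont: "continuous_on {-1..1} (\<lambda>x. poly q x / (\<eta> - x) ^ k)" for q k
    using Suc.prems by (intro continuous_intros) auto
  have int0: "((\<lambda>x. poly (rodrigues n (Suc j)) x / (\<eta> - x) ^ Suc N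
           + (real N + 1) * (poly (rodrigues n j) x / (\<eta> - x) ^ Suc (Suc N))) has_integral (?f 1 - ?f (-1))) {-1..1}"
  proof (rule fundamental_theorem_of_calculus)
    fix x :: real assume x: "x \<in> {-1..1}"
    then have ne: "\<eta> - x \<noteq> 0" using Suc.prems by auto
    have "(?f has_real_derivative (poly (rodrigues n (Suc j)) x * (\<eta> - x) ^ Suc N
        - poly (rodrigues n j) x * (- (real N + 1) * (\<eta> - x) ^ N)) / ((\<eta> - x) ^ Suc N * (\<eta> - x) ^ Suc N)) (at x)"
      using ne by (auto intro!: derivative_eq_intros simp del: power_Suc) (simp add: algebra_simps)
    also have "(poly (rodrigues n (Suc j)) x * (\<eta> - x) ^ Suc N
        - poly (rodrigues n j) x * (- (real N + 1) * (\<eta> - x) ^ N)) / ((\<eta> - x) ^ Suc N * (\<eta> - x) ^ Suc N)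
       = poly (rodrigues n (Suc j)) x / (\<eta> - x) ^ Suc N
           + (real N + 1) * (poly (rodrigues n j) x / (\<eta> - x) ^ Suc (Suc N))"
    proof -
      have "(A * e ^ Suc N - B * (- c * e ^ N)) / (e ^ Suc N * e ^ Suc N) = A / e ^ Suc N + c * (B / e ^ Suc (Suc N))"
        if "e \<noteq> 0" for A B c e :: real
        using that by (simp add: field_simps)
      from this[OF ne] show ?thesis .
    qed
    finally show "(?f has_vector_derivative poly (rodrigues n (Suc j)) x / (\<eta> - x) ^ Suc N
           + (real N + 1) * (poly (rodrigues n j) x / (\<eta> - x) ^ Suc (Suc N))) (at x within {-1..1})"
      by (auto simp: has_real_derivative_iff_has_vector_derivative intro: has_vector_derivative_at_within)
  qed simp
  have bdry: "?f 1 - ?f (-1) = 0"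
    using Suc.prems by (simp add: rodrigues_eq_0)
  have "((\<lambda>x. poly (rodrigues n (Suc j)) x / (\<eta> - x) ^ Suc N
           + (real N + 1) * (poly (rodrigues n j) x / (\<eta> - x) ^ Suc (Suc N))) has_integral
      (integral {-1..1} (\<lambda>x. poly (rodrigues n (Suc j)) x / (\<eta> - x) ^ Suc N)
        + (real N + 1) * integral {-1..1} (\<lambda>x. poly (rodrigues n j) x / (\<eta> - x) ^ Suc (Suc N)))) {-1..1}"
    by (intro has_integral_add has_integral_mult_right integrable_integral integrable_continuous_real cont)
  from has_integral_unique[OF this int0]
  have "integral {-1..1} (\<lambda>x. poly (rodrigues n (Suc j)) x / (\<eta> - x) ^ Suc N)
      = - (real N + 1) * integral {-1..1} (\<lambda>x. poly (rodrigues n j) x / (\<eta> - x) ^ Suc (Suc N))"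
    unfolding bdry mult_minus_left by (rule eq_neg_iff_add_eq_0[THEN iffD2])
  also have "\<dots> = (-1) ^ Suc j * ((real N + 1) * pochhammer (real N + 1 + 1) j)
      * integral {-1..1} (\<lambda>x. (x\<^sup>2 - 1) ^ n / (\<eta> - x) ^ Suc (N + Suc j))"
  proof -
    have e: "Suc N + j = N + Suc j" "real (Suc N) + 1 = real N + 1 + 1" by simp_all
    have "- (real N + 1) * (b * c * J) = (- 1 * b) * ((real N + 1) * c) * J" for b c J :: real
      by (simp add: algebra_simps)
    with Suc.IH[of "Suc N", unfolded e] Suc.prems show ?thesis by (simp only: power_Suc Suc_leD)
  qed
  finally show ?case by (simp only: pochhammer_rec)
qed

text \<open>The Beta integral B(j + 1/2, n + 1). Integrating the derivative of x^(2j+1) (1 -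
  x^2)^(n+1) raises the moment, and x^2 = 1 - (1 - x^2) brings it back, which closes the recursion
  in n at fixed j.\<close>

lemma even_moment:
  "((\<lambda>x. x ^ (2 * j) * (1 - x\<^sup>2) ^ n) has_integral
      Gamma (real j + 1/2) * fact n / Gamma (real n + real j + 3/2)) {-1..1::real}"
proof (induction n)
  case 0
  have "((\<lambda>x. x ^ (2 * j)) has_integral (1 ^ Suc (2 * j) / real (Suc (2 * j)) - (-1) ^ Suc (2 * j) / real (Suc (2 * j)))) {-1..1::real}"
  proof (rule fundamental_theorem_of_calculus)
    show "((\<lambda>x. x ^ Suc (2 * j) / real (Suc (2 * j))) has_vector_derivative x ^ (2 * j)) (at x within {-1..1})"
      for x :: real
      unfolding has_real_derivative_iff_has_vector_derivative[symmetric]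
      by (auto intro!: derivative_eq_intros simp del: power_Suc)
  qed simp
  moreover have "1 ^ Suc (2 * j) / real (Suc (2 * j)) - (-1) ^ Suc (2 * j) / real (Suc (2 * j))
      = Gamma (real j + 1/2) / Gamma (real j + 3/2)"
  proof -
    have "Gamma (real j + 1/2 + 1) = (real j + 1/2) * Gamma (real j + 1/2)"
      by (rule Gamma_plus1) (auto simp: nonpos_Ints_def)
    then have G: "Gamma (real j + 3/2) = (real j + 1/2) * Gamma (real j + 1/2)"
      by (simp add: add.assoc)
    have "Gamma (real j + 1/2) > 0"
      by (rule Gamma_real_pos) simp
    then have "Gamma (real j + 1/2) / Gamma (real j + 3/2) = 1 / (real j + 1/2)"
      unfolding G by (intro nonzero_divide_mult_cancel_right) (rule less_imp_neq[THEN not_sym])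
    moreover have "1 ^ Suc (2 * j) / real (Suc (2 * j)) - (-1) ^ Suc (2 * j) / real (Suc (2 * j)) = 1 / (real j + 1/2)"
      by (simp add: divide_simps)
    ultimately show ?thesis by (simp only:)
  qed
  ultimately show ?case by simp
next
  case (Suc n)
  let ?M = "\<lambda>k n. integral {-1..1} (\<lambda>x::real. x ^ k * (1 - x\<^sup>2) ^ n)"
  have int: "(\<lambda>x::real. x ^ k * (1 - x\<^sup>2) ^ n) integrable_on {-1..1}" for k n
    by (intro integrable_continuous_real continuous_intros)
  have int0: "((\<lambda>x. (2 * real j + 1) * (x ^ (2 * j) * (1 - x\<^sup>2) ^ Suc n)
       - 2 * (real n + 1) * (x ^ (2 * j + 2) * (1 - x\<^sup>2) ^ n)) has_integral
       (1 ^ Suc (2 * j) * (1 - 1\<^sup>2) ^ Suc n - (-1) ^ Suc (2 * j) * (1 - (-1)\<^sup>2) ^ Suc n)) {-1..1::real}"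
  proof (rule fundamental_theorem_of_calculus)
    show "((\<lambda>x. x ^ Suc (2 * j) * (1 - x\<^sup>2) ^ Suc n) has_vector_derivative
        (2 * real j + 1) * (x ^ (2 * j) * (1 - x\<^sup>2) ^ Suc n)
       - 2 * (real n + 1) * (x ^ (2 * j + 2) * (1 - x\<^sup>2) ^ n)) (at x within {-1..1})" for x :: real
      unfolding has_real_derivative_iff_has_vector_derivative[symmetric]
      by (auto intro!: derivative_eq_intros simp del: power_Suc) (simp add: algebra_simps power2_eq_square)
  qed simp
  have "((\<lambda>x. (2 * real j + 1) * (x ^ (2 * j) * (1 - x\<^sup>2) ^ Suc n)
       - 2 * (real n + 1) * (x ^ (2 * j + 2) * (1 - x\<^sup>2) ^ n)) has_integral
       ((2 * real j + 1) * ?M (2 * j) (Suc n) - 2 * (real n + 1) * ?M (2 * j + 2) n)) {-1..1::real}"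
    by (intro has_integral_diff has_integral_mult_right integrable_integral int)
  from has_integral_unique[OF this int0]
  have 1: "(2 * real j + 1) * ?M (2 * j) (Suc n) = 2 * (real n + 1) * ?M (2 * j + 2) n"
    by simp
  have "?M (2 * j) n - ?M (2 * j + 2) n = integral {-1..1} (\<lambda>x::real. x ^ (2 * j) * (1 - x\<^sup>2) ^ n - x ^ (2 * j + 2) * (1 - x\<^sup>2) ^ n)"
    by (rule integral_diff[symmetric]; rule int)
  also have "\<dots> = ?M (2 * j) (Suc n)"
    by (rule arg_cong[where f = "integral _"]) (auto simp: fun_eq_iff algebra_simps power2_eq_square)
  finally have 2: "?M (2 * j + 2) n = ?M (2 * j) n - ?M (2 * j) (Suc n)" by simp
  have 3: "?M (2 * j) (Suc n) * (real n + real j + 3/2) = (real n + 1) * ?M (2 * j) n"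
    using 1 unfolding 2 by (simp add: algebra_simps)
  have 4: "Gamma (real n + real j + 3/2 + 1) = (real n + real j + 3/2) * Gamma (real n + real j + 3/2)"
    by (rule Gamma_plus1) (auto simp: nonpos_Ints_def)
  have "?M (2 * j) (Suc n) = (real n + 1) * ?M (2 * j) n / (real n + real j + 3/2)"
    using 3 by (simp add: eq_divide_eq)
  also have "?M (2 * j) n = Gamma (real j + 1/2) * fact n / Gamma (real n + real j + 3/2)"
    using Suc.IH by (rule integral_unique)
  also have "(real n + 1) * (Gamma (real j + 1/2) * fact n / Gamma (real n + real j + 3/2)) / (real n + real j + 3/2)
      = Gamma (real j + 1/2) * fact (Suc n) / Gamma (real n + real j + 3/2 + 1)"
    unfolding 4 by (simp add: field_simps)
  finally show ?case
    using integrable_integral[OF int[of "2 * j" "Suc n"]] by (simp add: add_ac)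
qed

lemma odd_moment:
  "integral {-1..1} (\<lambda>x::real. x ^ Suc (2 * j) * (1 - x\<^sup>2) ^ n) = 0"
proof -
  have "integral {-1..1} (\<lambda>x::real. x ^ Suc (2 * j) * (1 - x\<^sup>2) ^ n)
      = integral {-1..1} (\<lambda>x::real. (- x) ^ Suc (2 * j) * (1 - (- x)\<^sup>2) ^ n)"
    using Henstock_Kurzweil_Integration.integral_reflect_real[of 1 "-1" "\<lambda>x::real. x ^ Suc (2 * j) * (1 - x\<^sup>2) ^ n"] by simp
  also have "\<dots> = - integral {-1..1} (\<lambda>x::real. x ^ Suc (2 * j) * (1 - x\<^sup>2) ^ n)"
    by simp
  finally show ?thesis by simp
qed

lemma negative_binomial_sums:
  fixes x \<eta> :: real
  assumes "\<bar>x\<bar> \<le> 1" "1 < \<eta>"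
  shows "(\<lambda>k. pochhammer (real N + 1) k / fact k / \<eta> ^ (Suc N + k) * x ^ k) sums (1 / (\<eta> - x) ^ Suc N)"
proof -
  have "\<bar>- x / \<eta>\<bar> < 1" using assms by simp
  then have "(\<lambda>k. ((- (real N + 1)) gchoose k) * (- x / \<eta>) ^ k) sums ((1 + (- x / \<eta>)) powr (- (real N + 1)))"
    by (rule gen_binomial_real)
  from sums_mult[OF this, of "1 / \<eta> ^ Suc N"]
  have "(\<lambda>k. 1 / \<eta> ^ Suc N * (((- (real N + 1)) gchoose k) * (- x / \<eta>) ^ k)) sums
     (1 / \<eta> ^ Suc N * (1 + (- x / \<eta>)) powr (- (real N + 1)))" .
  moreover have "1 / \<eta> ^ Suc N * (((- (real N + 1)) gchoose k) * (- x / \<eta>) ^ k)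
      = pochhammer (real N + 1) k / fact k / \<eta> ^ (Suc N + k) * x ^ k" for k
  proof -
    have "((- (real N + 1)) gchoose k) * (- x / \<eta>) ^ k = (-1) ^ k * (- x / \<eta>) ^ k * (pochhammer (real N + 1) k / fact k)"
      unfolding gbinomial_pochhammer minus_minus by (simp only: times_divide_eq_left times_divide_eq_right mult_ac)
    also have "(-1) ^ k * (- x / \<eta>) ^ k = (x / \<eta>) ^ k"
      unfolding power_mult_distrib[symmetric] by simp
    finally show ?thesis by (simp add: power_divide power_add mult_ac)
  qed
  moreover have "1 / \<eta> ^ Suc N * (1 + (- x / \<eta>)) powr (- (real N + 1)) = 1 / (\<eta> - x) ^ Suc N"
  proof -
    have e: "1 + (- x / \<eta>) = (\<eta> - x) / \<eta>" "(\<eta> - x) / \<eta> > 0" using assms by (simp_all add: field_simps)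
    have "(1 + (- x / \<eta>)) powr (- (real N + 1)) = 1 / ((\<eta> - x) / \<eta>) ^ Suc N"
      unfolding e(1) powr_minus_divide using powr_realpow[OF e(2), of "Suc N"] by (simp add: add_ac)
    then show ?thesis using assms by (simp add: power_divide del: power_Suc)
  qed
  ultimately show ?thesis by simp
qed

text \<open>The denominator is expanded in powers of x / \<eta> and integrated term by term. The
  coefficients are nonnegative and summable because the series converges at x = 1 < \<eta>, so they
  serve as the majorant on [-1, 1]; odd moments drop out.\<close>

lemma neumann_integral_sums:
  fixes \<eta> :: real
  assumes "1 < \<eta>"
  shows "(\<lambda>j. pochhammer (real N + 1) (2 * j) / fact (2 * j) / \<eta> ^ (Suc N + 2 * j)
            * (Gamma (real j + 1/2) * fact n / Gamma (real n + real j + 3/2)))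
          sums integral {-1..1} (\<lambda>x. (1 - x\<^sup>2) ^ n / (\<eta> - x) ^ Suc N)"
proof -
  define c where "c k = pochhammer (real N + 1) k / fact k / \<eta> ^ (Suc N + k)" for k
  have c_nonneg: "c k \<ge> 0" for k
    unfolding c_def using assms by (intro divide_nonneg_nonneg pochhammer_nonneg) auto
  have sums: "(\<lambda>k. c k * x ^ k) sums (1 / (\<eta> - x) ^ Suc N)" if "\<bar>x\<bar> \<le> 1" for x
    unfolding c_def by (rule negative_binomial_sums[OF that assms])
  let ?f = "\<lambda>k x. c k * (x ^ k * (1 - x\<^sup>2) ^ n)"
  have "uniform_limit {-1..1} (\<lambda>K x. \<Sum>k<K. ?f k x) (\<lambda>x. \<Sum>k. ?f k x) sequentially"
  proof (rule Weierstrass_m_test)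
    show "norm (?f k x) \<le> c k" if "x \<in> {-1..1}" for k and x :: real
    proof -
      have "\<bar>x\<bar> ^ k \<le> 1" "0 \<le> 1 - x\<^sup>2" "1 - x\<^sup>2 \<le> 1"
        using that by (auto intro!: power_le_one simp: abs_square_le_1)
      then have "\<bar>x\<bar> ^ k * (1 - x\<^sup>2) ^ n \<le> 1"
        by (intro mult_le_one power_le_one[of "1 - x\<^sup>2"] zero_le_power) auto
      from mult_left_mono[OF this c_nonneg[of k]] show ?thesis
        using \<open>0 \<le> 1 - x\<^sup>2\<close> c_nonneg[of k] by (simp add: abs_mult power_abs)
    qed
    show "summable c" using sums[of 1] by (simp add: sums_iff)
  qed
  moreover have "(\<Sum>k. ?f k x) = (1 - x\<^sup>2) ^ n / (\<eta> - x) ^ Suc N" if "x \<in> {-1..1}" for x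
    using sums_mult2[OF sums[of x], of "(1 - x\<^sup>2) ^ n"] that
    by (intro sums_unique[symmetric]) (auto simp: mult_ac)
  ultimately have "uniform_limit {-1..1} (\<lambda>K x. \<Sum>k<K. ?f k x) (\<lambda>x. (1 - x\<^sup>2) ^ n / (\<eta> - x) ^ Suc N) sequentially"
    by (subst (asm) uniform_limit_cong') auto
  then obtain I J where I: "\<And>K. ((\<lambda>x. \<Sum>k<K. ?f k x) has_integral I K) {-1..1}"
    and J: "((\<lambda>x. (1 - x\<^sup>2) ^ n / (\<eta> - x) ^ Suc N) has_integral J) {-1..1}" and lim: "I \<longlonglongrightarrow> J"
    by (rule uniform_limit_integral) (auto intro!: continuous_intros)
  let ?M = "\<lambda>k. integral {-1..1} (\<lambda>x::real. x ^ k * (1 - x\<^sup>2) ^ n)"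
  have int: "(\<lambda>x::real. x ^ k * (1 - x\<^sup>2) ^ n) integrable_on {-1..1}" for k
    by (intro integrable_continuous_real continuous_intros)
  have "((\<lambda>x. \<Sum>k<K. ?f k x) has_integral (\<Sum>k<K. c k * ?M k)) {-1..1}" for K
    by (intro has_integral_sum has_integral_mult_right integrable_integral int) auto
  from has_integral_unique[OF I this] have "I = (\<lambda>K. \<Sum>k<K. c k * ?M k)" by (rule ext)
  with lim have "(\<lambda>k. c k * ?M k) sums J"
    by (simp only: sums_def)
  moreover have "c k * ?M k = 0" if "k \<notin> range ((*) 2)" for k
  proof -
    have "odd k" using that by (auto elim!: evenE)
    then obtain j where "k = Suc (2 * j)" by (auto elim!: oddE)
    then show ?thesis using odd_moment[of j n] by simp
  qed
  ultimately have "(\<lambda>j. c (2 * j) * ?M (2 * j)) sums J"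
    by (subst sums_mono_reindex[of "(*) 2" "\<lambda>k. c k * ?M k"]) (auto intro!: strict_monoI)
  moreover have "?M (2 * j) = Gamma (real j + 1/2) * fact n / Gamma (real n + real j + 3/2)" for j
    using even_moment by (rule integral_unique)
  ultimately show ?thesis
    unfolding c_def integral_unique[OF J] by simp
qed

section \<open>Legendre functions of complex type at real arguments\<close>

lemma Gamma_nat_plus_half: "Gamma (real j + 1/2) = sqrt pi * pochhammer (1/2) j"
proof -
  have "(1/2 :: real) \<notin> \<int>\<^sub>\<le>\<^sub>0"
    using nonpos_Ints_nonpos by force
  then show ?thesis
    using pochhammer_Gamma[of "1/2 :: real" j] by (simp add: Gamma_one_half_real add_ac field_simps)
qed

lemma fact_double_pochhammer_half: "fact (2 * j) = 4 ^ j * pochhammer (1/2) j * (fact j :: real)"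
  using pochhammer_double[of "1/2 :: real" j] by (simp add: power_mult pochhammer_fact)

text \<open>Reflection and n - m integrations by parts reduce the integral to
  \<open>neumann_integral_sums\<close>. The duplication formula for Pochhammer symbols then turns
  its terms into those of the series in \<open>legendreQ\<close>; the factors 4^j and (1/2)_j
  cancel.\<close>

lemma integral_dlegendre_over_power:
  fixes \<eta> :: real
  assumes "m \<le> n" "1 < \<eta>"
  shows "(\<lambda>j. pochhammer ((real n + real m) / 2 + 1) j * pochhammer ((real n + real m + 1) / 2) j
            * rGamma (real n + 3/2 + real j) / fact j * (1 / \<eta>\<^sup>2) ^ j)
     sums (fact (n - m) * fact (2 * m) * 2 ^ n * \<eta> ^ Suc (n + m) / ((fact (n + m))\<^sup>2 * sqrt pi)
       * integral {-1..1} (\<lambda>x. (1 - x\<^sup>2) ^ m * poly (dlegendre m n) x / (\<eta> - x) ^ Suc (2 * m)))"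
proof -
  let ?J = "integral {-1..1} (\<lambda>x. (1 - x\<^sup>2) ^ n / (\<eta> - x) ^ Suc (n + m))"
  have neg: "(1 - x\<^sup>2) ^ k = (-1) ^ k * (x\<^sup>2 - 1) ^ k" for x :: real and k
    by (simp flip: power_mult_distrib)
  have poch: "pochhammer (real (2 * m) + 1) (n - m) = fact (n + m) / fact (2 * m)"
  proof -
    have e: "2 * m + (n - m) = n + m" "1 + real (2 * m) = real (2 * m) + 1" using assms by simp_all
    have "fact (n + m) = fact (2 * m) * pochhammer (real (2 * m) + 1) (n - m)"
      using pochhammer_product'[of "1::real" "2 * m" "n - m"] unfolding e pochhammer_fact .
    then show ?thesis by simp
  qed
  have "(1 - x\<^sup>2) ^ m * poly (dlegendre m n) x
      = (-1) ^ m * fact (n + m) / (fact (n - m) * 2 ^ n * fact n) * poly (rodrigues n (n - m)) x" for x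
    using rodrigues_reflect[OF assms(1), of x] by (simp add: dlegendre_def neg field_simps)
  then have "integral {-1..1} (\<lambda>x. (1 - x\<^sup>2) ^ m * poly (dlegendre m n) x / (\<eta> - x) ^ Suc (2 * m))
      = integral {-1..1} (\<lambda>x. (-1) ^ m * fact (n + m) / (fact (n - m) * 2 ^ n * fact n)
          * (poly (rodrigues n (n - m)) x / (\<eta> - x) ^ Suc (2 * m)))"
    by simp
  also have "\<dots> = (-1) ^ m * fact (n + m) / (fact (n - m) * 2 ^ n * fact n)
      * ((-1) ^ (n - m) * pochhammer (real (2 * m) + 1) (n - m)
         * integral {-1..1} (\<lambda>x. (x\<^sup>2 - 1) ^ n / (\<eta> - x) ^ Suc (2 * m + (n - m))))"
    using assms by (simp only: integral_mult_right integral_rodrigues_by_parts diff_le_self)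
  also have "2 * m + (n - m) = n + m" using assms by simp
  also have "(\<lambda>x. (x\<^sup>2 - 1) ^ n / (\<eta> - x) ^ Suc (n + m)) = (\<lambda>x. (-1) ^ n * ((1 - x\<^sup>2) ^ n / (\<eta> - x) ^ Suc (n + m)))"
    unfolding neg by (simp add: fun_eq_iff flip: power_add mult_2)
  also have "integral {-1..1} \<dots> = (-1) ^ n * ?J"
    by (rule integral_mult_right)
  also have "(-1) ^ m * fact (n + m) / (fact (n - m) * 2 ^ n * fact n)
      * ((-1) ^ (n - m) * pochhammer (real (2 * m) + 1) (n - m) * ((-1) ^ n * ?J))
      = ((-1) ^ m * (-1) ^ (n - m) * (-1) ^ n) * ((fact (n + m))\<^sup>2 / (fact (n - m) * fact (2 * m) * 2 ^ n * fact n) * ?J)"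
    unfolding poch by (simp add: power2_eq_square mult_ac)
  \<comment> \<open>The signs come from the reflected weight, from the integrations by parts and
    from (x^2 - 1)^n; their exponents add up to 2 n.\<close>
  also have "(-1) ^ m * (-1) ^ (n - m) * (-1) ^ n = (1::real)"
    using assms by (simp flip: power_add mult_2)
  finally have I: "integral {-1..1} (\<lambda>x. (1 - x\<^sup>2) ^ m * poly (dlegendre m n) x / (\<eta> - x) ^ Suc (2 * m))
      = (fact (n + m))\<^sup>2 / (fact (n - m) * fact (2 * m) * 2 ^ n * fact n) * ?J" by simp
  have eq: "\<eta> ^ Suc (n + m) / (fact n * sqrt pi) *
      (pochhammer (real (n + m) + 1) (2 * j) / fact (2 * j) / \<eta> ^ (Suc (n + m) + 2 * j)
            * (Gamma (real j + 1/2) * fact n / Gamma (real n + real j + 3/2)))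
     = pochhammer ((real n + real m) / 2 + 1) j * pochhammer ((real n + real m + 1) / 2) j
            * rGamma (real n + 3/2 + real j) / fact j * (1 / \<eta>\<^sup>2) ^ j" for j
  proof -
    define A B H where "A = pochhammer ((real n + real m) / 2 + 1) j"
      "B = pochhammer ((real n + real m + 1) / 2) j" "H = pochhammer (1/2 :: real) j"
    have 1: "pochhammer (real (n + m) + 1) (2 * j) = 4 ^ j * B * A"
      using pochhammer_double[of "(real n + real m + 1) / 2" j]
      by (simp add: A_B_H_def power_mult add_divide_distrib add_ac)
    have 2: "fact (2 * j) = 4 ^ j * H * (fact j :: real)" and 3: "Gamma (real j + 1/2) = sqrt pi * H"
      unfolding A_B_H_def by (rule fact_double_pochhammer_half Gamma_nat_plus_half)+
    have "H > 0" unfolding A_B_H_def by (rule pochhammer_pos) simp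
    show ?thesis
      unfolding 1 2 3 rGamma_inverse_Gamma A_B_H_def(1,2)[symmetric]
      using \<open>H > 0\<close> assms by (simp add: power_add field_simps flip: power_mult)
  qed
  have "fact (n - m) * fact (2 * m) * 2 ^ n * \<eta> ^ Suc (n + m) / ((fact (n + m))\<^sup>2 * sqrt pi)
       * ((fact (n + m))\<^sup>2 / (fact (n - m) * fact (2 * m) * 2 ^ n * fact n) * ?J) = \<eta> ^ Suc (n + m) / (fact n * sqrt pi) * ?J"
    by (simp del: power_Suc)
  with sums_mult[OF neumann_integral_sums[OF assms(2), of "n + m" n], of "\<eta> ^ Suc (n + m) / (fact n * sqrt pi)"]
  show ?thesis
    unfolding eq I by simp
qed

text \<open>The degree is an arbitrary real so that one reduction covers both uses: degree n with
  order m, and degree m - 1/2 with order 0. For z at least 1 all principal powers are real.\<close>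

lemma legendreQ_of_real:
  fixes z \<nu> s :: real and m :: nat
  assumes z: "1 \<le> z"
    and sums: "(\<lambda>k. pochhammer ((\<nu> + real m) / 2 + 1) k * pochhammer ((\<nu> + real m + 1) / 2) k
                 * rGamma (\<nu> + 3/2 + real k) / fact k * (1 / z\<^sup>2) ^ k) sums s"
  shows "legendreQ (of_nat m) (of_real \<nu>) (of_real z) = of_real ((-1) ^ m * sqrt pi * Gamma (\<nu> + real m + 1)
     * (z\<^sup>2 - 1) powr (real m / 2) / (2 powr (\<nu> + 1) * z powr (\<nu> + real m + 1)) * s)"
proof -
  have "exp (of_nat m * of_real pi * \<i>) = (-1) ^ m"
    unfolding mult.assoc exp_of_nat_mult by simp
  moreover have "Gamma (of_real \<nu> + of_nat m + 1) = complex_of_real (Gamma (\<nu> + real m + 1))"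
    by (simp flip: Gamma_complex_of_real)
  moreover have "((of_real z)\<^sup>2 - 1) powr (of_nat m / 2) = complex_of_real ((z\<^sup>2 - 1) powr (real m / 2))"
    using z by (simp flip: powr_of_real)
  moreover have "2 powr (of_real \<nu> + 1) = complex_of_real (2 powr (\<nu> + 1))"
    by (simp flip: powr_of_real)
  moreover have "of_real z powr (of_real \<nu> + of_nat m + 1) = complex_of_real (z powr (\<nu> + real m + 1))"
    using z by (simp flip: powr_of_real)
  moreover have "hyp2F1_reg ((of_real \<nu> + of_nat m) / 2 + 1) ((of_real \<nu> + of_nat m + 1) / 2) (of_real \<nu> + 3 / 2)
      (1 / (of_real z)\<^sup>2) = of_real s"
  proof -
    have "(\<lambda>k. complex_of_real (pochhammer ((\<nu> + real m) / 2 + 1) k * pochhammer ((\<nu> + real m + 1) / 2) k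
                 * rGamma (\<nu> + 3/2 + real k) / fact k * (1 / z\<^sup>2) ^ k)) sums of_real s"
      using sums by (rule sums_of_real)
    then show ?thesis
      unfolding hyp2F1_reg_def
      by (intro sums_unique[symmetric])
         (simp flip: pochhammer_of_real rGamma_complex_of_real)
  qed
  ultimately show ?thesis
    by (simp add: legendreQ_def)
qed

text \<open>For m = 0 this is Neumann's formula. The integral is the one to which the kernel reduces
  at y = \<xi> = 1.\<close>

lemma legendreQ_eq_integral:
  fixes \<eta> :: real
  assumes "m \<le> n" "1 < \<eta>"
  shows "legendreQ (of_nat m) (of_nat n) (of_real \<eta>)
     = of_real ((-1) ^ m * fact (n - m) * fact (2 * m) / (2 * fact (n + m)) * (\<eta>\<^sup>2 - 1) powr (real m / 2)
         * integral {-1..1} (\<lambda>x. (1 - x\<^sup>2) ^ m * poly (dlegendre m n) x / (\<eta> - x) ^ Suc (2 * m)))"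
proof -
  let ?I = "integral {-1..1} (\<lambda>x. (1 - x\<^sup>2) ^ m * poly (dlegendre m n) x / (\<eta> - x) ^ Suc (2 * m))"
  have G: "Gamma (real n + real m + 1) = fact (n + m)"
    using Gamma_fact[of "n + m", where 'a = real] by (simp add: add_ac)
  have p: "2 powr (real n + 1) = 2 * (2::real) ^ n" "\<eta> powr (real n + real m + 1) = \<eta> ^ Suc (n + m)"
    using powr_realpow[of 2 "Suc n"] powr_realpow[of \<eta> "Suc (n + m)"] assms by (simp_all add: add_ac)
  have "legendreQ (of_nat m) (of_real (real n)) (of_real \<eta>) = of_real ((-1) ^ m * sqrt pi * Gamma (real n + real m + 1)
     * (\<eta>\<^sup>2 - 1) powr (real m / 2) / (2 powr (real n + 1) * \<eta> powr (real n + real m + 1))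
     * (fact (n - m) * fact (2 * m) * 2 ^ n * \<eta> ^ Suc (n + m) / ((fact (n + m))\<^sup>2 * sqrt pi) * ?I))"
    using assms by (intro legendreQ_of_real integral_dlegendre_over_power) auto
  also have "(-1) ^ m * sqrt pi * Gamma (real n + real m + 1)
     * (\<eta>\<^sup>2 - 1) powr (real m / 2) / (2 powr (real n + 1) * \<eta> powr (real n + real m + 1))
     * (fact (n - m) * fact (2 * m) * 2 ^ n * \<eta> ^ Suc (n + m) / ((fact (n + m))\<^sup>2 * sqrt pi) * ?I)
     = (-1) ^ m * fact (n - m) * fact (2 * m) / (2 * fact (n + m)) * (\<eta>\<^sup>2 - 1) powr (real m / 2) * ?I"
    unfolding G p using assms by (simp add: power2_eq_square del: power_Suc)
  finally show ?thesis by simp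
qed

lemma square_powr_half:
  fixes x :: real
  assumes "0 < x"
  shows "(x\<^sup>2) powr (real m / 2) = x ^ m"
proof -
  have "x ^ m = x powr (2 * (real m / 2))"
    using powr_realpow[OF assms, of m] by simp
  also have "\<dots> = (x powr 2) powr (real m / 2)"
    by (simp only: powr_powr)
  also have "x powr 2 = x\<^sup>2"
    using assms by (intro powr_numeral) simp
  finally show ?thesis ..
qed

text \<open>The regularized series is finite at both ends: \<open>rGamma\<close> vanishes at
  nonpositive integers, which kills k < m, and the Pochhammer symbol of -n kills k > n. Shifting the
  index by m leaves (\<xi> - 1)^m times the Taylor polynomial of \<open>dlegendre\<close> at
  1.\<close>

lemma legendreP_eq_poly:
  fixes \<xi> :: real
  assumes "m \<le> n" "1 < \<xi>"
  shows "legendreP (of_nat m) (of_nat n) (of_real \<xi>) = of_real ((\<xi>\<^sup>2 - 1) powr (real m / 2) * poly (dlegendre m n) \<xi>)"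
proof -
  let ?t = "\<lambda>k. pochhammer (real n + 1) k * pochhammer (- real n) k * rGamma (1 - real m + real k) / fact k * ((1 - \<xi>) / 2) ^ k"
  have zero: "?t k = 0" if "k \<notin> {m..n}" for k
  proof (cases "k < m")
    case True
    then have e: "1 - real m + real k = - real (m - 1 - k)" by (simp add: of_nat_diff)
    have "rGamma (1 - real m + real k) = 0" unfolding e rGamma_eq_zero_iff by simp
    then show ?thesis by simp
  next
    case False
    then have "pochhammer (- real n) k = 0"
      using that by (intro pochhammer_of_nat_eq_0_lemma) auto
    then show ?thesis by simp
  qed
  have shifted: "?t (m + j) = (\<xi> - 1) ^ m *
      (fact (n + m + j) / (fact (n - m - j) * fact (m + j) * fact j * 2 ^ (m + j)) * (\<xi> - 1) ^ j)"
    if "j \<le> n - m" for j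
  proof -
    have "m + j \<le> n" using that assms by simp
    have 1: "pochhammer (real n + 1) (m + j) = fact (n + m + j) / fact n"
      using pochhammer_product'[of "1::real" n "m + j"]
      by (simp add: pochhammer_fact[symmetric] add_ac)
    have "(-1) ^ (m + j) * pochhammer (- real n) (m + j) = real (n choose (m + j)) * fact (m + j)"
      by (simp add: binomial_gbinomial gbinomial_pochhammer)
    also have "\<dots> = fact n / fact (n - m - j)"
      using binomial_fact[OF \<open>m + j \<le> n\<close>, where 'a = real] by simp
    finally have "(-1) ^ (m + j) * pochhammer (- real n) (m + j) = fact n / fact (n - m - j)" .
    then have "(-1) ^ (m + j) * ((-1) ^ (m + j) * pochhammer (- real n) (m + j)) = (-1) ^ (m + j) * (fact n / fact (n - m - j))"
      by (simp only:)
    then have 2: "pochhammer (- real n) (m + j) = (-1) ^ (m + j) * (fact n / fact (n - m - j))"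
      unfolding mult.assoc[symmetric] power_mult_distrib[symmetric] by simp
    have 3: "rGamma (1 - real m + real (m + j)) = 1 / fact j"
      using Gamma_fact[of j, where 'a = real] by (simp add: rGamma_inverse_Gamma inverse_eq_divide)
    have 4: "(-1) ^ (m + j) * ((1 - \<xi>) / 2) ^ (m + j) = (\<xi> - 1) ^ m * (\<xi> - 1) ^ j / 2 ^ (m + j)"
    proof -
      have "(-1) ^ (m + j) * ((1 - \<xi>) / 2) ^ (m + j) = ((\<xi> - 1) / 2) ^ (m + j)"
        unfolding power_mult_distrib[symmetric] by (simp add: minus_divide_left)
      then show ?thesis by (simp add: power_divide power_add)
    qed
    have "?t (m + j) = fact (n + m + j) / fact n * (fact n / fact (n - m - j)) * (1 / fact j) / fact (m + j)
        * ((-1) ^ (m + j) * ((1 - \<xi>) / 2) ^ (m + j))"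
      unfolding 1 2 3 by simp
    then show ?thesis
      unfolding 4 by (simp add: mult_ac)
  qed
  have "?t sums (\<Sum>k\<in>{m..n}. ?t k)"
    by (rule sums_finite) (use zero in auto)
  also have "(\<Sum>k\<in>{m..n}. ?t k) = (\<Sum>j\<le>n - m. ?t (m + j))"
    by (rule sum.reindex_bij_witness[of _ "\<lambda>j. m + j" "\<lambda>k. k - m"]) (use assms in auto)
  also have "\<dots> = (\<xi> - 1) ^ m * poly (dlegendre m n) \<xi>"
    unfolding dlegendre_taylor[OF assms(1)] sum_distrib_left by (rule sum.cong) (simp_all only: shifted atMost_iff)
  finally have "(\<lambda>k. complex_of_real (?t k)) sums of_real ((\<xi> - 1) ^ m * poly (dlegendre m n) \<xi>)"
    by (rule sums_of_real)
  then have hyp: "hyp2F1_reg (of_nat n + 1) (- of_nat n) (1 - of_nat m) ((1 - of_real \<xi>) / 2)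
      = of_real ((\<xi> - 1) ^ m * poly (dlegendre m n) \<xi>)"
    unfolding hyp2F1_reg_def
    by (intro sums_unique[symmetric]) (simp flip: pochhammer_of_real rGamma_complex_of_real)
  have "((of_real \<xi> + 1) / (of_real \<xi> - 1)) powr (of_nat m / 2) = complex_of_real (((\<xi> + 1) / (\<xi> - 1)) powr (real m / 2))"
    using assms by (simp flip: powr_of_real)
  moreover have "((\<xi> + 1) / (\<xi> - 1)) powr (real m / 2) * (\<xi> - 1) ^ m = (\<xi>\<^sup>2 - 1) powr (real m / 2)"
  proof -
    have sq: "(\<xi> - 1) ^ m = ((\<xi> - 1)\<^sup>2) powr (real m / 2)"
      using assms by (intro square_powr_half[symmetric]) simp
    have "((\<xi> + 1) / (\<xi> - 1)) powr (real m / 2) * (\<xi> - 1) ^ m = ((\<xi> + 1) / (\<xi> - 1) * (\<xi> - 1)\<^sup>2) powr (real m / 2)"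
      unfolding sq by (rule powr_mult[symmetric])
    also have "(\<xi> + 1) / (\<xi> - 1) * (\<xi> - 1)\<^sup>2 = \<xi>\<^sup>2 - 1"
      using assms by (simp add: power2_eq_square field_simps)
    finally show ?thesis .
  qed
  ultimately show ?thesis
    unfolding legendreP_def hyp by (simp flip: of_real_mult of_real_power)
qed

text \<open>Here r is the square root of S, so the hypergeometric argument is 4 S / D^2. The divisor
  m! relates the regularized series to \<open>ring_coeff\<close>, which is normalized to start with
  1.\<close>

lemma legendreQ_half_eq_kern:
  fixes D r :: real
  assumes "r > 0" "2 * r < D"
  shows "legendreQ 0 (of_nat m - 1/2) (of_real (D / (2 * r)))
     = of_real (sqrt pi * Gamma (real m + 1/2) / fact m * r powr (real m + 1/2) * kern m D (r\<^sup>2))"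
proof -
  define z where "z = D / (2 * r)"
  have z: "z > 1" using assms by (simp add: z_def)
  have u: "4 * r\<^sup>2 / D\<^sup>2 = 1 / z\<^sup>2"
    by (simp add: z_def power_divide power_mult_distrib)
  have "\<bar>1 / z\<^sup>2\<bar> < 1" using z by (simp add: one_less_power)
  from summable_ring_coeff[OF this, of m]
  have "(\<lambda>k. ring_coeff m k * (1 / z\<^sup>2) ^ k) sums power_sum (ring_coeff m) (1 / z\<^sup>2)"
    unfolding power_sum_def by (rule summable_sums)
  from sums_divide[OF this, of "fact m"]
  have sums: "(\<lambda>k. pochhammer ((real m - 1/2 + real 0) / 2 + 1) k * pochhammer ((real m - 1/2 + real 0 + 1) / 2) k
      * rGamma (real m - 1/2 + 3/2 + real k) / fact k * (1 / z\<^sup>2) ^ k) sums (power_sum (ring_coeff m) (1 / z\<^sup>2) / fact m)"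
  proof (rule sums_cong[THEN iffD1, rotated])
    fix k
    have "rGamma (real m - 1/2 + 3/2 + real k) = 1 / fact (m + k)"
      using Gamma_fact[of "m + k", where 'a = real] by (simp add: rGamma_inverse_Gamma inverse_eq_divide add_ac)
    moreover have "fact (m + k) = fact m * pochhammer (real m + 1) k"
      using pochhammer_product'[of "1::real" m k] by (simp add: pochhammer_fact[symmetric] add_ac)
    moreover have "(real m - 1/2 + real 0) / 2 + 1 = (real m + 3/2) / 2" "(real m - 1/2 + real 0 + 1) / 2 = (real m + 1/2) / 2"
      by (simp_all add: field_simps)
    ultimately show "ring_coeff m k * (1 / z\<^sup>2) ^ k / fact m =
       pochhammer ((real m - 1/2 + real 0) / 2 + 1) k * pochhammer ((real m - 1/2 + real 0 + 1) / 2) k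
      * rGamma (real m - 1/2 + 3/2 + real k) / fact k * (1 / z\<^sup>2) ^ k"
      by (simp only: ring_coeff_def) (simp add: mult_ac)
  qed
  have "legendreQ (of_nat 0) (of_real (real m - 1/2)) (of_real z)
      = of_real ((-1) ^ 0 * sqrt pi * Gamma (real m - 1/2 + real 0 + 1) * (z\<^sup>2 - 1) powr (real 0 / 2)
          / (2 powr (real m - 1/2 + 1) * z powr (real m - 1/2 + real 0 + 1)) * (power_sum (ring_coeff m) (1 / z\<^sup>2) / fact m))"
    using z by (intro legendreQ_of_real sums) auto
  \<comment> \<open>In HOL \<open>0 powr 0\<close> is 0, so this step relies on z being different
    from 1.\<close>
  also have "(z\<^sup>2 - 1) powr (real 0 / 2) = 1"
    using z by (simp add: power2_eq_1_iff)
  also have "real m - 1/2 + real 0 + 1 = real m + 1/2" by simp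
  also have "real m - 1/2 + 1 = real m + 1/2" by simp
  also have "2 powr (real m + 1/2) * z powr (real m + 1/2) = D powr (real m + 1/2) / r powr (real m + 1/2)"
  proof -
    have "2 powr (real m + 1/2) * z powr (real m + 1/2) = (2 * z) powr (real m + 1/2)"
      using z by (simp add: powr_mult)
    also have "2 * z = D / r" by (simp add: z_def)
    also have "(D / r) powr (real m + 1/2) = D powr (real m + 1/2) / r powr (real m + 1/2)"
      using assms by (simp add: powr_divide)
    finally show ?thesis .
  qed
  also have "(-1) ^ 0 * sqrt pi * Gamma (real m + 1/2) * 1 / (D powr (real m + 1/2) / r powr (real m + 1/2))
        * (power_sum (ring_coeff m) (1 / z\<^sup>2) / fact m)
      = sqrt pi * Gamma (real m + 1/2) / fact m * r powr (real m + 1/2) * kern m D (r\<^sup>2)"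
    unfolding kern_def u powr_minus_divide by simp
  finally show ?thesis
    by (simp add: z_def)
qed

subsection \<open>The integral of the kernel\<close>

text \<open>With \<open>\<xi> = cosh \<sigma>\<close> and \<open>\<eta> = cosh \<sigma>'\<close> the roots of \<open>a\<^sup>2 - 2\<xi>\<eta>a + \<xi>\<^sup>2 + \<eta>\<^sup>2 - 1\<close> are
  \<open>cosh (\<sigma> - \<sigma>')\<close> and \<open>cosh (\<sigma> + \<sigma>')\<close>; this gives the factorization of the discriminant.\<close>
lemma ring_discriminant_bound:
  fixes \<sigma> \<sigma>' x y :: real
  defines "\<xi> \<equiv> cosh \<sigma>" and "\<eta> \<equiv> cosh \<sigma>'"
  assumes "0 < \<sigma>" "0 < \<sigma>'" "x \<in> {-1..1}" "y \<in> {-1..1}"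
  shows "(\<eta> - 1)\<^sup>2 * (x - y)\<^sup>2 \<le> (ring_D y x \<xi> \<eta>)\<^sup>2 - 4 * ring_S y x \<xi> \<eta>"
proof -
  define a b where "a = cosh (\<sigma> - \<sigma>')" "b = cosh (\<sigma> + \<sigma>')"
  have sq: "(sinh \<sigma>)\<^sup>2 = \<xi>\<^sup>2 - 1" "(sinh \<sigma>')\<^sup>2 = \<eta>\<^sup>2 - 1"
    by (simp_all add: \<xi>_def \<eta>_def sinh_square_eq)
  have a: "a = \<xi> * \<eta> - sinh \<sigma> * sinh \<sigma>'" and b: "b = \<xi> * \<eta> + sinh \<sigma> * sinh \<sigma>'"
    by (simp_all add: a_b_def \<xi>_def \<eta>_def cosh_diff cosh_add)
  have sum: "a + b = 2 * (\<xi> * \<eta>)" unfolding a b by simp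
  have "a * b = (\<xi> * \<eta>)\<^sup>2 - (sinh \<sigma>)\<^sup>2 * (sinh \<sigma>')\<^sup>2"
    unfolding a b by (simp add: power2_eq_square algebra_simps)
  then have prod: "a * b = \<xi>\<^sup>2 + \<eta>\<^sup>2 - 1"
    unfolding sq by (simp add: algebra_simps power_mult_distrib)
  have "a \<ge> 1" by (simp add: a_b_def cosh_real_ge_1)
  have "b \<ge> \<eta>" "\<eta> \<ge> 1"
    using assms by (auto simp: a_b_def \<eta>_def cosh_real_ge_1 cosh_real_nonneg_le_iff)
  define w t where "w = x * y" "t = x\<^sup>2 + y\<^sup>2 - 1"
  have "w \<le> 1"
  proof -
    have "\<bar>x * y\<bar> \<le> 1 * 1" unfolding abs_mult using assms by (intro mult_mono) auto
    then show ?thesis by (simp add: w_t_def)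
  qed
  have xy: "(x - y)\<^sup>2 = 1 + t - 2 * w" by (simp add: w_t_def power2_eq_square algebra_simps)
  have D: "ring_D y x \<xi> \<eta> = a * b + t - (a + b) * w"
    unfolding prod sum by (simp add: ring_D_def w_t_def algebra_simps)
  have S: "4 * ring_S y x \<xi> \<eta> = (w\<^sup>2 - t) * ((a + b)\<^sup>2 - 4 * (a * b))"
    unfolding prod sum by (simp add: ring_S_def w_t_def algebra_simps power2_eq_square)
  have fac: "(ring_D y x \<xi> \<eta>)\<^sup>2 - 4 * ring_S y x \<xi> \<eta> = (a\<^sup>2 - 2 * a * w + t) * (b\<^sup>2 - 2 * b * w + t)"
    unfolding D S by (simp add: algebra_simps power2_eq_square)
  \<comment> \<open>Equality holds at \<open>a\<close> = 1, that is for \<sigma> = \<sigma>': this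
    factor carries the whole singularity, while the other one is bounded below independently of
    \<sigma>.\<close>
  have A: "(x - y)\<^sup>2 \<le> a\<^sup>2 - 2 * a * w + t"
  proof -
    have "a\<^sup>2 - 2 * a * w + t - (x - y)\<^sup>2 = (a - 1) * ((a - 1) + 2 * (1 - w))"
      unfolding xy by (simp add: algebra_simps power2_eq_square)
    moreover have "\<dots> \<ge> 0" using \<open>a \<ge> 1\<close> \<open>w \<le> 1\<close> by (intro mult_nonneg_nonneg) auto
    ultimately show ?thesis by simp
  qed
  have B: "(\<eta> - 1)\<^sup>2 \<le> b\<^sup>2 - 2 * b * w + t"
  proof -
    have "b\<^sup>2 - 2 * b * w + t = (b - 1)\<^sup>2 + (b - 1) * (2 * (1 - w)) + (x - y)\<^sup>2"
      unfolding xy by (simp add: algebra_simps power2_eq_square)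
    moreover have "(b - 1) * (2 * (1 - w)) \<ge> 0"
      using \<open>b \<ge> \<eta>\<close> \<open>\<eta> \<ge> 1\<close> \<open>w \<le> 1\<close> by (intro mult_nonneg_nonneg) auto
    moreover have "(\<eta> - 1)\<^sup>2 \<le> (b - 1)\<^sup>2"
      using \<open>b \<ge> \<eta>\<close> \<open>\<eta> \<ge> 1\<close> by (intro power_mono) auto
    ultimately show ?thesis using zero_le_power2[of "x - y"] by linarith
  qed
  have "(\<eta> - 1)\<^sup>2 * (x - y)\<^sup>2 \<le> (b\<^sup>2 - 2 * b * w + t) * (a\<^sup>2 - 2 * a * w + t)"
    using A B order.trans[OF zero_le_power2 B] by (intro mult_mono) auto
  then show ?thesis unfolding fac by (simp add: mult.commute)
qed

section \<open>Domain and bounds of the kernel near coinciding points\<close>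

lemma cosh_real_gt_1: "(0::real) < \<sigma> \<Longrightarrow> 1 < cosh \<sigma>"
  by (metis cosh_0 cosh_real_nonneg_less_iff less_imp_le order_refl)

text \<open>The two summands dropped are those that contain \<xi>, so the lower bound is uniform in
  \<sigma>, as dominated convergence requires.\<close>

lemma ring_D_ge:
  fixes \<xi> \<eta> x y :: real
  assumes "1 \<le> \<xi>" "x \<in> {-1..1}"
  shows "(\<eta>\<^sup>2 - 1) * (1 - y\<^sup>2) \<le> ring_D y x \<xi> \<eta>"
proof -
  have "ring_D y x \<xi> \<eta> = (\<xi>\<^sup>2 - 1) * (1 - x\<^sup>2) + (\<eta>\<^sup>2 - 1) * (1 - y\<^sup>2) + (\<xi> * x - \<eta> * y)\<^sup>2"
    by (simp add: ring_D_def algebra_simps power2_eq_square)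
  moreover have "(\<xi>\<^sup>2 - 1) * (1 - x\<^sup>2) \<ge> 0"
    using assms by (intro mult_nonneg_nonneg) (auto simp: abs_square_le_1 one_le_power)
  ultimately show ?thesis using zero_le_power2[of "\<xi> * x - \<eta> * y"] by linarith
qed

lemma ring_S_nonneg:
  fixes \<xi> \<eta> x y :: real
  assumes "1 \<le> \<xi>" "1 \<le> \<eta>" "x \<in> {-1..1}" "y \<in> {-1..1}"
  shows "0 \<le> ring_S y x \<xi> \<eta>"
proof -
  have "ring_S y x \<xi> \<eta> = (1 - y\<^sup>2) * (1 - x\<^sup>2) * ((\<xi>\<^sup>2 - 1) * (\<eta>\<^sup>2 - 1))"
    by (simp add: ring_S_def algebra_simps)
  also have "\<dots> \<ge> 0"
    using assms by (intro mult_nonneg_nonneg) (auto simp: abs_square_le_1 one_le_power)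
  finally show ?thesis .
qed

lemma ring_dom_cosh:
  fixes \<sigma> \<sigma>' x y :: real
  assumes "0 < \<sigma>" "0 < \<sigma>'" "x \<in> {-1..1}" "y \<in> {-1<..<1}" "x \<noteq> y"
  shows "ring_dom y x (cosh \<sigma>) (cosh \<sigma>')"
proof -
  have ge1: "cosh \<sigma> > 1" "cosh \<sigma>' > 1"
    using assms by (simp_all add: cosh_real_gt_1)
  have "(cosh \<sigma>')\<^sup>2 > 1" "y\<^sup>2 < 1"
    using assms ge1 by (auto simp: abs_square_less_1 abs_less_iff one_less_power)
  then have "0 < ((cosh \<sigma>')\<^sup>2 - 1) * (1 - y\<^sup>2)" by simp
  with ring_D_ge[of "cosh \<sigma>" x "cosh \<sigma>'" y] have D: "0 < ring_D y x (cosh \<sigma>) (cosh \<sigma>')"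
    using assms ge1 by simp
  have "0 < (cosh \<sigma>' - 1)\<^sup>2 * (x - y)\<^sup>2" using ge1 assms by simp
  also have "\<dots> \<le> (ring_D y x (cosh \<sigma>) (cosh \<sigma>'))\<^sup>2 - 4 * ring_S y x (cosh \<sigma>) (cosh \<sigma>')"
    by (rule ring_discriminant_bound) (use assms in auto)
  finally have "4 * \<bar>ring_S y x (cosh \<sigma>) (cosh \<sigma>')\<bar> < (ring_D y x (cosh \<sigma>) (cosh \<sigma>'))\<^sup>2"
    using ring_S_nonneg[of "cosh \<sigma>" "cosh \<sigma>'" x y] ge1 assms by simp
  with D show ?thesis by (simp add: ring_dom_def kern_dom_def)
qed

lemma ring_integral_less:
  fixes \<sigma> \<sigma>' y :: real and m n :: nat
  defines "p \<equiv> poly (dlegendre m n)"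
  assumes "m \<le> n" "0 < \<sigma>" "\<sigma> < \<sigma>'" "y \<in> {-1..1}"
  shows "((\<lambda>\<theta>. sin \<theta> * ((1 - (cos \<theta>)\<^sup>2) ^ m * p (cos \<theta>) * ring_kernel m y (cos \<theta>) (cosh \<sigma>) (cosh \<sigma>')))
    has_integral p y * p (cosh \<sigma>) / (p 1)\<^sup>2 *
      integral {-1..1} (\<lambda>x. (1 - x\<^sup>2) ^ m * p x / (cosh \<sigma>' - x) ^ Suc (2 * m))) {0..pi}"
proof -
  define \<xi> \<eta> where "\<xi> = cosh \<sigma>" "\<eta> = cosh \<sigma>'"
  have \<xi>\<eta>: "1 < \<xi>" "\<xi> < \<eta>"
    using assms by (auto simp: \<xi>_\<eta>_def cosh_real_gt_1 cosh_real_nonneg_less_iff)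
  let ?f = "\<lambda>x. (1 - x\<^sup>2) ^ m * p x * ring_kernel m y x \<xi> \<eta>"
  have "p 1 > 0" unfolding p_def using \<open>m \<le> n\<close> by (rule dlegendre_pos) simp
  have cont: "continuous_on {-1..1} ?f"
    unfolding p_def
    by (intro continuous_on_mult ring_continuous_on ring_dom_ellipses continuous_intros)
       (use \<xi>\<eta> assms in auto)
  have eq: "integral {-1..1} (\<lambda>x. (1 - x\<^sup>2) ^ m * p x * ring_kernel m 1 x 1 \<eta>)
      = integral {-1..1} (\<lambda>x. (1 - x\<^sup>2) ^ m * p x / (\<eta> - x) ^ Suc (2 * m))"
  proof (rule integral_cong)
    fix x :: real assume "x \<in> {-1..1}"
    then have pos: "\<eta> - x > 0" using \<xi>\<eta> by simp
    have D: "ring_D 1 x 1 \<eta> = (\<eta> - x)\<^sup>2" and S: "ring_S 1 x 1 \<eta> = 0"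
      by (simp_all add: ring_D_def ring_S_def power2_eq_square algebra_simps)
    have "((\<eta> - x)\<^sup>2) powr t = (\<eta> - x) powr (2 * t)" for t
      using pos by (simp add: powr_powr flip: powr_numeral)
    also have "2 * (- (real m + 1/2)) = - real (Suc (2 * m))" by simp
    also have "(\<eta> - x) powr (- real (Suc (2 * m))) = 1 / (\<eta> - x) ^ Suc (2 * m)"
      unfolding powr_minus_divide using pos by (simp only: powr_realpow)
    finally show "(1 - x\<^sup>2) ^ m * p x * ring_kernel m 1 x 1 \<eta> = (1 - x\<^sup>2) ^ m * p x / (\<eta> - x) ^ Suc (2 * m)"
      unfolding ring_kernel_def D S kern_def by simp
  qed
  have "integral {-1..1} ?f * (p 1)\<^sup>2 = p y * p \<xi> * integral {-1..1} (\<lambda>x. (1 - x\<^sup>2) ^ m * p x * ring_kernel m 1 x 1 \<eta>)"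
    unfolding p_def using assms \<xi>\<eta> by (intro ring_integral_factorizes) auto
  then have I: "integral {-1..1} ?f = p y * p \<xi> / (p 1)\<^sup>2 * integral {-1..1} (\<lambda>x. (1 - x\<^sup>2) ^ m * p x / (\<eta> - x) ^ Suc (2 * m))"
    unfolding eq using \<open>p 1 > 0\<close> by (simp add: field_simps)
  \<comment> \<open>The cosine reverses the interval: \<open>{cos 0..cos pi}\<close> is empty, so
    the first integral is 0 and the second carries the sign.\<close>
  have "((\<lambda>\<theta>. - sin \<theta> *\<^sub>R ?f (cos \<theta>)) has_integral (integral {cos 0..cos pi} ?f - integral {cos pi..cos 0} ?f)) {0..pi}"
    by (rule has_integral_substitution_general[where s = "{}" and c = "-1" and d = 1])
       (use cont in \<open>auto intro!: continuous_intros derivative_eq_intros\<close>)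
  then have "((\<lambda>\<theta>. - sin \<theta> * ?f (cos \<theta>)) has_integral (- integral {-1..1} ?f)) {0..pi}"
    by simp
  from has_integral_neg[OF this] show ?thesis
    unfolding I unfolding \<xi>_\<eta>_def by simp
qed

lemma inverse_sqrt_cos_integrable:
  "(\<lambda>\<theta>. sin \<theta> / sqrt \<bar>cos \<theta> - cos \<theta>'\<bar>) integrable_on {0..pi}"
  if "\<theta>' \<in> {0..pi}" for \<theta>' :: real
proof -
  \<comment> \<open>\<open>sqrt\<close> is odd, so a single antiderivative covers both sides of the singularity\<close>
  have "((\<lambda>\<theta>. sin \<theta> / sqrt \<bar>cos \<theta> - cos \<theta>'\<bar>) has_integral
      (- 2 * sqrt (cos pi - cos \<theta>')) - (- 2 * sqrt (cos 0 - cos \<theta>'))) {0..pi}"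
  proof (rule fundamental_theorem_of_calculus_interior_strong[where S = "{\<theta>'}"])
    fix \<theta> :: real assume \<theta>: "\<theta> \<in> {0<..<pi} - {\<theta>'}"
    have ne: "cos \<theta> - cos \<theta>' \<noteq> 0"
      using cos_inj_pi[of \<theta> \<theta>'] \<theta> that by auto
    have "((\<lambda>\<theta>. - 2 * sqrt (cos \<theta> - cos \<theta>')) has_real_derivative
        - 2 * ((1 / sqrt \<bar>cos \<theta> - cos \<theta>'\<bar> / 2) * (- sin \<theta>))) (at \<theta>)"
    proof (rule DERIV_cmult, rule DERIV_chain2[where f = sqrt])
      show "(sqrt has_real_derivative 1 / sqrt \<bar>cos \<theta> - cos \<theta>'\<bar> / 2) (at (cos \<theta> - cos \<theta>'))"
      proof (rule DERIV_real_sqrt_generic[OF ne])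
        assume "cos \<theta> - cos \<theta>' < 0"
        then have "sqrt \<bar>cos \<theta> - cos \<theta>'\<bar> = - sqrt (cos \<theta> - cos \<theta>')"
          by (simp add: abs_of_neg flip: real_sqrt_minus)
        then show "1 / sqrt \<bar>cos \<theta> - cos \<theta>'\<bar> / 2 = - inverse (sqrt (cos \<theta> - cos \<theta>')) / 2"
          by (simp add: inverse_eq_divide)
      qed (simp add: inverse_eq_divide)
    qed (auto intro!: derivative_eq_intros)
    then show "((\<lambda>\<theta>. - 2 * sqrt (cos \<theta> - cos \<theta>')) has_vector_derivative sin \<theta> / sqrt \<bar>cos \<theta> - cos \<theta>'\<bar>) (at \<theta>)"
      by (simp add: has_real_derivative_iff_has_vector_derivative)
  qed (auto intro!: continuous_intros)
  then show ?thesis by (rule has_integral_integrable)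
qed

text \<open>By \<open>ring_discriminant_bound\<close>, 1 - u is at least a multiple of (x - y)^2 /
  D^2, so the growth (1 - u)^(-1/4) becomes the integrable |x - y|^(-1/2). The resulting D^(1/2)
  leaves D^(-m), for which a lower bound on D suffices. The constant does not depend on
  \<sigma>.\<close>

lemma ring_bound:
  fixes \<sigma>' y :: real
  assumes "0 < \<sigma>'" "y \<in> {-1<..<1}"
  obtains K where "K \<ge> 0" "\<And>\<sigma> x. 0 < \<sigma> \<Longrightarrow> x \<in> {-1..1} \<Longrightarrow> x \<noteq> y \<Longrightarrow>
    \<bar>ring_kernel m y x (cosh \<sigma>) (cosh \<sigma>')\<bar> \<le> K / sqrt \<bar>x - y\<bar>"
proof -
  define \<eta> where "\<eta> = cosh \<sigma>'"
  define \<beta> where "\<beta> = (\<eta>\<^sup>2 - 1) * (1 - y\<^sup>2)"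
  have \<eta>: "1 < \<eta>" using assms by (simp add: \<eta>_def cosh_real_gt_1)
  then have "\<eta>\<^sup>2 > 1" "y\<^sup>2 < 1"
    using assms by (auto simp: abs_square_less_1 abs_less_iff one_less_power)
  then have \<beta>: "\<beta> > 0" by (simp add: \<beta>_def)
  obtain C where C: "C > 0" "\<And>u. 0 \<le> u \<Longrightarrow> u < 1 \<Longrightarrow>
      0 \<le> power_sum (ring_coeff m) u \<and> power_sum (ring_coeff m) u \<le> C * (1 - u) powr (-1/4)"
    using ring_series_bound by blast
  define K where "K = C * \<beta> powr (- real m) / sqrt (\<eta> - 1)"
  have "\<bar>ring_kernel m y x (cosh \<sigma>) \<eta>\<bar> \<le> K / sqrt \<bar>x - y\<bar>"
    if \<sigma>: "0 < \<sigma>" and x: "x \<in> {-1..1}" "x \<noteq> y" for \<sigma> x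
  proof -
    define D S where "D = ring_D y x (cosh \<sigma>) \<eta>" "S = ring_S y x (cosh \<sigma>) \<eta>"
    define u where "u = 4 * S / D\<^sup>2"
    have "\<beta> \<le> D" unfolding \<beta>_def D_S_def using x by (intro ring_D_ge cosh_real_ge_1)
    with \<beta> have D: "D > 0" by simp
    have "kern_dom D S"
      using ring_dom_cosh[OF \<sigma> assms(1) x(1) assms(2) x(2)] by (simp add: ring_dom_def D_S_def \<eta>_def)
    moreover have "S \<ge> 0"
      unfolding D_S_def using x assms \<eta> by (intro ring_S_nonneg cosh_real_ge_1) auto
    ultimately have u: "0 \<le> u" "u < 1"
      using kern_dom_less_1[of D S] by (auto simp: u_def)
    have "(\<eta> - 1)\<^sup>2 * (x - y)\<^sup>2 \<le> D\<^sup>2 - 4 * S"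
      unfolding D_S_def \<eta>_def using \<sigma> assms x by (intro ring_discriminant_bound) auto
    also have "\<dots> = (1 - u) * D\<^sup>2" using D by (simp add: u_def field_simps)
    finally have le: "((\<eta> - 1) * \<bar>x - y\<bar> / D)\<^sup>2 \<le> 1 - u"
      using D by (simp add: power_divide power_mult_distrib divide_le_eq)
    have q: "(\<eta> - 1) * \<bar>x - y\<bar> / D > 0" using \<eta> x D by simp
    have "(1 - u) powr (-1/4) \<le> (((\<eta> - 1) * \<bar>x - y\<bar> / D)\<^sup>2) powr (-1/4)"
      using le q by (intro powr_mono2') auto
    also have "\<dots> = ((\<eta> - 1) * \<bar>x - y\<bar> / D) powr (-1/2)"
      using q by (simp add: powr_powr flip: powr_numeral)
    also have "\<dots> = D powr (1/2) / (sqrt (\<eta> - 1) * sqrt \<bar>x - y\<bar>)"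
      using \<eta> x D by (simp add: powr_divide powr_mult powr_minus_divide powr_half_sqrt real_sqrt_mult real_sqrt_divide)
    finally have bd: "(1 - u) powr (-1/4) \<le> D powr (1/2) / (sqrt (\<eta> - 1) * sqrt \<bar>x - y\<bar>)" .
    have r: "ring_kernel m y x (cosh \<sigma>) \<eta> = D powr (- (real m + 1/2)) * power_sum (ring_coeff m) u"
      by (simp add: ring_kernel_def kern_def D_S_def u_def)
    then have "\<bar>ring_kernel m y x (cosh \<sigma>) \<eta>\<bar> = D powr (- (real m + 1/2)) * power_sum (ring_coeff m) u"
      using C(2)[OF u] by simp
    also have "\<dots> \<le> D powr (- (real m + 1/2)) * (C * (1 - u) powr (-1/4))"
      using C(2)[OF u] by (intro mult_left_mono) auto
    also have "\<dots> \<le> D powr (- (real m + 1/2)) * (C * (D powr (1/2) / (sqrt (\<eta> - 1) * sqrt \<bar>x - y\<bar>)))"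
      using bd C(1) by (intro mult_left_mono) auto
    also have "\<dots> = C * (D powr (- (real m + 1/2)) * D powr (1/2)) / sqrt (\<eta> - 1) / sqrt \<bar>x - y\<bar>"
      by simp
    also have "D powr (- (real m + 1/2)) * D powr (1/2) = D powr (- real m)"
      by (simp flip: powr_add)
    also have "C * D powr (- real m) / sqrt (\<eta> - 1) / sqrt \<bar>x - y\<bar> \<le> K / sqrt \<bar>x - y\<bar>"
      unfolding K_def using C(1) \<beta> \<open>\<beta> \<le> D\<close> \<eta>
      by (intro divide_right_mono mult_left_mono powr_mono2') auto
    finally show ?thesis .
  qed
  moreover have "K \<ge> 0" unfolding K_def using C(1) \<eta> by simp
  ultimately show ?thesis using that unfolding \<eta>_def by blast
qed

text \<open>The smaller parameter increases to \<sigma> while the larger one stays put, so on the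
  right-hand side only the value of p at \<open>cosh (s k)\<close> varies.\<close>

lemma ring_integral_eq:
  fixes \<sigma> \<theta>' :: real and m n :: nat
  defines "p \<equiv> poly (dlegendre m n)"
  assumes "m \<le> n" "0 < \<sigma>" "0 < \<theta>'" "\<theta>' < pi"
  shows "((\<lambda>\<theta>. sin \<theta> * ((1 - (cos \<theta>)\<^sup>2) ^ m * p (cos \<theta>) * ring_kernel m (cos \<theta>') (cos \<theta>) (cosh \<sigma>) (cosh \<sigma>)))
    has_integral p (cos \<theta>') * p (cosh \<sigma>) / (p 1)\<^sup>2 *
      integral {-1..1} (\<lambda>x. (1 - x\<^sup>2) ^ m * p x / (cosh \<sigma> - x) ^ Suc (2 * m))) {0..pi}"
proof -
  define y where "y = cos \<theta>'"
  let ?N = "integral {-1..1} (\<lambda>x. (1 - x\<^sup>2) ^ m * p x / (cosh \<sigma> - x) ^ Suc (2 * m))"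
  let ?f = "\<lambda>s \<theta>. sin \<theta> * ((1 - (cos \<theta>)\<^sup>2) ^ m * p (cos \<theta>) * ring_kernel m y (cos \<theta>) (cosh s) (cosh \<sigma>))"
  have y: "y \<in> {-1<..<1}"
    using cos_monotone_0_pi[of 0 \<theta>'] cos_monotone_0_pi[of \<theta>' pi] assms by (auto simp: y_def)
  have ne: "cos \<theta> \<noteq> y" if "\<theta> \<in> {0..pi} - {\<theta>'}" for \<theta>
    using cos_inj_pi[of \<theta> \<theta>'] that assms by (auto simp: y_def)
  obtain K where K: "K \<ge> 0" "\<And>s x. 0 < s \<Longrightarrow> x \<in> {-1..1} \<Longrightarrow> x \<noteq> y \<Longrightarrow>
      \<bar>ring_kernel m y x (cosh s) (cosh \<sigma>)\<bar> \<le> K / sqrt \<bar>x - y\<bar>"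
    using ring_bound[OF \<open>0 < \<sigma>\<close> y] by blast
  have "compact ((\<lambda>x. (1 - x\<^sup>2) ^ m * p x) ` {-1..1})"
    unfolding p_def by (intro compact_continuous_image continuous_intros) auto
  then obtain L where L: "\<And>x. x \<in> {-1..1} \<Longrightarrow> \<bar>(1 - x\<^sup>2) ^ m * p x\<bar> \<le> L"
    using compact_imp_bounded bounded_iff by (metis (mono_tags, lifting) image_eqI real_norm_def)
  have "L \<ge> 0" using L[of 0] by force
  \<comment> \<open>The shift by 2 keeps \<open>s 0\<close> positive.\<close>
  define s where "s k = \<sigma> - \<sigma> / real (k + 2)" for k
  have s: "0 < s k" "s k < \<sigma>" for k
    using \<open>0 < \<sigma>\<close> by (simp_all add: s_def field_simps add_pos_nonneg)
  have s_lim: "s \<longlonglongrightarrow> \<sigma>"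
  proof -
    have "(\<lambda>k. \<sigma> - \<sigma> / real (k + 2)) \<longlonglongrightarrow> \<sigma> - 0"
      by (intro tendsto_diff tendsto_const LIMSEQ_ignore_initial_segment[of "\<lambda>k. \<sigma> / real k"] lim_const_over_n)
    then show ?thesis by (simp add: s_def[abs_def])
  qed
  \<comment> \<open>At \<theta>' the majorant divides by 0 and is therefore 0 in HOL; setting the
    integrands to 0 there makes the pointwise bound hold on the whole interval.\<close>
  have "((\<lambda>\<theta>. if \<theta> = \<theta>' then 0 else ?f \<sigma> \<theta>) has_integral p y * p (cosh \<sigma>) / (p 1)\<^sup>2 * ?N) {0..pi}"
  proof (rule has_integral_dominated_convergence)
    show "((\<lambda>\<theta>. if \<theta> = \<theta>' then 0 else ?f (s k) \<theta>) has_integral p y * p (cosh (s k)) / (p 1)\<^sup>2 * ?N) {0..pi}" for k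
    proof (rule has_integral_spike_finite[of "{\<theta>'}"])
      show "(?f (s k) has_integral p y * p (cosh (s k)) / (p 1)\<^sup>2 * ?N) {0..pi}"
        unfolding p_def using s[of k] y assms by (intro ring_integral_less) auto
    qed auto
    show "(\<lambda>\<theta>. L * K * (sin \<theta> / sqrt \<bar>cos \<theta> - cos \<theta>'\<bar>)) integrable_on {0..pi}"
      using assms by (intro integrable_on_mult_right inverse_sqrt_cos_integrable) auto
    show "\<forall>\<theta>\<in>{0..pi}. norm (if \<theta> = \<theta>' then 0 else ?f (s k) \<theta>) \<le> L * K * (sin \<theta> / sqrt \<bar>cos \<theta> - cos \<theta>'\<bar>)" for k
    proof
      fix \<theta> assume \<theta>: "\<theta> \<in> {0..pi}"
      have sin: "sin \<theta> \<ge> 0" using \<theta> by (intro sin_ge_zero) auto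
      show "norm (if \<theta> = \<theta>' then 0 else ?f (s k) \<theta>) \<le> L * K * (sin \<theta> / sqrt \<bar>cos \<theta> - cos \<theta>'\<bar>)"
      proof (cases "\<theta> = \<theta>'")
        case False
        have "norm (?f (s k) \<theta>) = sin \<theta> * (\<bar>(1 - (cos \<theta>)\<^sup>2) ^ m * p (cos \<theta>)\<bar> * \<bar>ring_kernel m y (cos \<theta>) (cosh (s k)) (cosh \<sigma>)\<bar>)"
          using sin by (simp add: abs_mult)
        also have "\<dots> \<le> sin \<theta> * (L * (K / sqrt \<bar>cos \<theta> - y\<bar>))"
          using sin \<open>L \<ge> 0\<close> s[of k] ne[of \<theta>] \<theta> False by (intro mult_left_mono mult_mono L K) auto
        finally show ?thesis using False by (simp add: y_def mult_ac)
      qed simp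
    qed
    show "\<forall>\<theta>\<in>{0..pi}. (\<lambda>k. if \<theta> = \<theta>' then 0 else ?f (s k) \<theta>) \<longlonglongrightarrow> (if \<theta> = \<theta>' then 0 else ?f \<sigma> \<theta>)"
    proof
      fix \<theta> assume \<theta>: "\<theta> \<in> {0..pi}"
      show "(\<lambda>k. if \<theta> = \<theta>' then 0 else ?f (s k) \<theta>) \<longlonglongrightarrow> (if \<theta> = \<theta>' then 0 else ?f \<sigma> \<theta>)"
      proof (cases "\<theta> = \<theta>'")
        case False
        have "continuous_on {0<..} (\<lambda>s. ring_kernel m y (cos \<theta>) (cosh s) (cosh \<sigma>))"
          by (intro ring_continuous_on ring_dom_cosh continuous_intros)
             (use False \<theta> y ne[of \<theta>] \<open>0 < \<sigma>\<close> in auto)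
        then have "(\<lambda>k. ring_kernel m y (cos \<theta>) (cosh (s k)) (cosh \<sigma>)) \<longlonglongrightarrow> ring_kernel m y (cos \<theta>) (cosh \<sigma>) (cosh \<sigma>)"
          by (rule continuous_on_tendsto_compose[OF _ s_lim]) (use s \<open>0 < \<sigma>\<close> in auto)
        then have "(\<lambda>k. ?f (s k) \<theta>) \<longlonglongrightarrow> ?f \<sigma> \<theta>"
          by (intro tendsto_intros)
        then show ?thesis using False by simp
      qed simp
    qed
    show "(\<lambda>k. p y * p (cosh (s k)) / (p 1)\<^sup>2 * ?N) \<longlonglongrightarrow> p y * p (cosh \<sigma>) / (p 1)\<^sup>2 * ?N"
      unfolding p_def by (intro tendsto_intros s_lim) (use dlegendre_pos[OF \<open>m \<le> n\<close>, of 1] in simp)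
  qed
  then show ?thesis
    unfolding y_def by (rule has_integral_spike_finite[of "{\<theta>'}", rotated 2]) auto
qed

lemma ring_integral:
  fixes \<sigma> \<sigma>' \<theta>' :: real and m n :: nat
  defines "p \<equiv> poly (dlegendre m n)"
  assumes "m \<le> n" "0 < \<sigma>" "0 < \<sigma>'" "0 < \<theta>'" "\<theta>' < pi"
  shows "((\<lambda>\<theta>. sin \<theta> * ((1 - (cos \<theta>)\<^sup>2) ^ m * p (cos \<theta>) * ring_kernel m (cos \<theta>') (cos \<theta>) (cosh \<sigma>) (cosh \<sigma>')))
    has_integral p (cos \<theta>') * p (cosh (min \<sigma> \<sigma>')) / (p 1)\<^sup>2 *
      integral {-1..1} (\<lambda>x. (1 - x\<^sup>2) ^ m * p x / (cosh (max \<sigma> \<sigma>') - x) ^ Suc (2 * m))) {0..pi}"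
proof -
  have swap: "ring_kernel m u v c d = ring_kernel m u v d c" for u v c d
    by (simp add: ring_kernel_def ring_D_def ring_S_def mult_ac add_ac)
  consider "\<sigma> < \<sigma>'" | "\<sigma> = \<sigma>'" | "\<sigma>' < \<sigma>" by linarith
  then show ?thesis
  proof cases
    case 1
    then show ?thesis
      using ring_integral_less[of m n \<sigma> \<sigma>' "cos \<theta>'"] assms by (simp add: p_def min_def max_def)
  next
    case 2
    then show ?thesis
      using ring_integral_eq[of m n \<sigma> \<theta>'] assms by (simp add: p_def)
  next
    case 3
    then show ?thesis
      using ring_integral_less[of m n \<sigma>' \<sigma> "cos \<theta>'"] assms
      by (simp add: p_def min_def max_def swap[of _ _ "cosh \<sigma>" "cosh \<sigma>'"])
  qed
qed

section \<open>Translation back to the original functions\<close>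

lemma sinh_min_max: "sinh (min \<sigma> \<sigma>') * sinh (max \<sigma> \<sigma>') = sinh \<sigma> * sinh (\<sigma>' :: real)"
  by (cases "\<sigma> \<le> \<sigma>'") (simp_all add: min_def max_def mult.commute)

theorem theorem3p3:
  fixes m n :: nat and \<sigma> \<sigma>' \<theta>' :: real
  assumes "m \<le> n" and "0 < \<sigma>" and "0 < \<sigma>'" and "0 < \<theta>'" and "\<theta>' < pi"
  shows "((\<lambda>\<theta>. legendreQ 0 (of_nat m - 1/2) (of_real (chi \<sigma> \<sigma>' \<theta> \<theta>'))
              * of_real (ferrersP m n (cos \<theta>) * sqrt (sin \<theta>)))
         has_integral
           (of_real (2 * pi * (-1) ^ m * fact (n - m) / fact (n + m)
              * sqrt (sinh \<sigma> * sinh \<sigma>' * sin \<theta>') * ferrersP m n (cos \<theta>'))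
            * legendreP (of_nat m) (of_nat n) (of_real (cosh (min \<sigma> \<sigma>')))
            * legendreQ (of_nat m) (of_nat n) (of_real (cosh (max \<sigma> \<sigma>')))))
         {0..pi}"
proof -
  define p where "p = poly (dlegendre m n)"
  define q where "q = sinh \<sigma> * sinh \<sigma>' * sin \<theta>'"
  define N where "N = integral {-1..1} (\<lambda>x. (1 - x\<^sup>2) ^ m * p x / (cosh (max \<sigma> \<sigma>') - x) ^ Suc (2 * m))"
  \<comment> \<open>With R R' = \<open>q\<close> sin \<theta>, this collects the factors of the
    integrand that do not depend on \<theta>; the sign is that of the Ferrers function.\<close>
  define c where "c = sqrt pi * Gamma (real m + 1/2) / fact m * q powr (real m + 1/2) * (-1) ^ m"
  let ?g = "\<lambda>\<theta>. sin \<theta> * ((1 - (cos \<theta>)\<^sup>2) ^ m * p (cos \<theta>) * ring_kernel m (cos \<theta>') (cos \<theta>) (cosh \<sigma>) (cosh \<sigma>'))"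
  have sin': "sin \<theta>' > 0" using assms by (intro sin_gt_zero) auto
  then have q: "q > 0" using assms by (simp add: q_def)
  have y: "cos \<theta>' \<in> {-1<..<1}"
    using cos_monotone_0_pi[of 0 \<theta>'] cos_monotone_0_pi[of \<theta>' pi] assms by auto

  have lhs: "legendreQ 0 (of_nat m - 1/2) (of_real (chi \<sigma> \<sigma>' \<theta> \<theta>'))
      * of_real (ferrersP m n (cos \<theta>) * sqrt (sin \<theta>)) = of_real (c * ?g \<theta>)"
    if \<theta>: "\<theta> \<in> {0..pi} - {0, pi, \<theta>'}" for \<theta>
  proof -
    have sin: "sin \<theta> > 0" using \<theta> by (intro sin_gt_zero) auto
    have ne: "cos \<theta> \<noteq> cos \<theta>'" using cos_inj_pi[of \<theta> \<theta>'] \<theta> assms by auto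
    define r where "r = q * sin \<theta>"
    define D where "D = ring_D (cos \<theta>') (cos \<theta>) (cosh \<sigma>) (cosh \<sigma>')"
    have r: "r > 0" using q sin by (simp add: r_def)
    have S: "ring_S (cos \<theta>') (cos \<theta>) (cosh \<sigma>) (cosh \<sigma>') = r\<^sup>2"
    proof -
      have "r\<^sup>2 = (sinh \<sigma>)\<^sup>2 * (sinh \<sigma>')\<^sup>2 * (sin \<theta>')\<^sup>2 * (sin \<theta>)\<^sup>2"
        by (simp add: r_def q_def power_mult_distrib)
      then show ?thesis
        by (simp add: ring_S_def sinh_square_eq sin_squared_eq algebra_simps)
    qed
    have "kern_dom D (r\<^sup>2)"
      using ring_dom_cosh[of \<sigma> \<sigma>' "cos \<theta>" "cos \<theta>'"] assms y ne by (simp add: ring_dom_def S D_def)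
    then have less: "(2 * r)\<^sup>2 < D\<^sup>2" and "D > 0"
      by (auto simp: kern_dom_def power_mult_distrib)
    have "2 * r < D"
      by (rule power2_less_imp_less[OF less]) (use \<open>D > 0\<close> in simp)
    moreover have "kern m D (r\<^sup>2) = ring_kernel m (cos \<theta>') (cos \<theta>) (cosh \<sigma>) (cosh \<sigma>')"
      unfolding ring_kernel_def S D_def ..
    ultimately have Q: "legendreQ 0 (of_nat m - 1/2) (of_real (D / (2 * r)))
        = of_real (sqrt pi * Gamma (real m + 1/2) / fact m * r powr (real m + 1/2)
            * ring_kernel m (cos \<theta>') (cos \<theta>) (cosh \<sigma>) (cosh \<sigma>'))"
      using legendreQ_half_eq_kern[OF r, of D m] by (simp only:)
    have chi: "chi \<sigma> \<sigma>' \<theta> \<theta>' = D / (2 * r)"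
      by (simp add: chi_def D_def r_def q_def ring_D_def sin_squared_eq mult_ac)
    have F: "ferrersP m n (cos \<theta>) = (-1) ^ m * sin \<theta> ^ m * p (cos \<theta>)"
      unfolding ferrersP_eq_poly sin_squared_eq[symmetric] square_powr_half[OF sin] p_def by simp
    \<comment> \<open>The prefactor of the kernel gives sin^(m+1/2), the Ferrers function sin^m, and
      the integrand sqrt(sin). Together they are the weight (1 - x^2)^m and the Jacobian of x = cos
      \<theta>.\<close>
    have powers: "sin \<theta> powr (real m + 1/2) * (sin \<theta> ^ m * sqrt (sin \<theta>)) = sin \<theta> * (1 - (cos \<theta>)\<^sup>2) ^ m"
    proof -
      have "sin \<theta> powr (real m + 1/2) = sin \<theta> ^ m * sqrt (sin \<theta>)"
        using sin by (simp add: powr_add powr_realpow powr_half_sqrt)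
      then have "sin \<theta> powr (real m + 1/2) * (sin \<theta> ^ m * sqrt (sin \<theta>))
          = (sqrt (sin \<theta>) * sqrt (sin \<theta>)) * (sin \<theta> ^ m * sin \<theta> ^ m)"
        by simp
      also have "\<dots> = sin \<theta> * (1 - (cos \<theta>)\<^sup>2) ^ m"
        unfolding sin_squared_eq[symmetric] using sin by (simp add: power2_eq_square power_mult_distrib)
      finally show ?thesis .
    qed
    have "r powr (real m + 1/2) = q powr (real m + 1/2) * sin \<theta> powr (real m + 1/2)"
      using q sin by (simp add: r_def powr_mult)
    then have "sqrt pi * Gamma (real m + 1/2) / fact m * r powr (real m + 1/2)
            * ring_kernel m (cos \<theta>') (cos \<theta>) (cosh \<sigma>) (cosh \<sigma>') * (ferrersP m n (cos \<theta>) * sqrt (sin \<theta>))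
        = sqrt pi * Gamma (real m + 1/2) / fact m * q powr (real m + 1/2) * (-1) ^ m
           * (sin \<theta> powr (real m + 1/2) * (sin \<theta> ^ m * sqrt (sin \<theta>)) * p (cos \<theta>)
              * ring_kernel m (cos \<theta>') (cos \<theta>) (cosh \<sigma>) (cosh \<sigma>'))"
      unfolding F by (simp add: mult_ac)
    also have "\<dots> = c * ?g \<theta>"
      unfolding powers by (simp add: c_def mult_ac)
    finally show ?thesis
      unfolding chi Q of_real_mult[symmetric] by (simp only:)
  qed

  have rhs: "of_real (2 * pi * (-1) ^ m * fact (n - m) / fact (n + m) * sqrt q * ferrersP m n (cos \<theta>'))
            * legendreP (of_nat m) (of_nat n) (of_real (cosh (min \<sigma> \<sigma>')))
            * legendreQ (of_nat m) (of_nat n) (of_real (cosh (max \<sigma> \<sigma>')))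
      = complex_of_real (c * (p (cos \<theta>') * p (cosh (min \<sigma> \<sigma>')) / (p 1)\<^sup>2 * N))"
  proof -
    have gt: "0 < min \<sigma> \<sigma>'" "0 < max \<sigma> \<sigma>'" using assms by auto
    have cosh: "(cosh x)\<^sup>2 - 1 = (sinh x)\<^sup>2" for x :: real
      by (simp add: sinh_square_eq)
    have P: "legendreP (of_nat m) (of_nat n) (of_real (cosh (min \<sigma> \<sigma>')))
        = of_real (sinh (min \<sigma> \<sigma>') ^ m * p (cosh (min \<sigma> \<sigma>')))"
      unfolding legendreP_eq_poly[OF assms(1) cosh_real_gt_1[OF gt(1)]] cosh p_def
      using gt by (simp add: square_powr_half)
    have Q: "legendreQ (of_nat m) (of_nat n) (of_real (cosh (max \<sigma> \<sigma>')))
        = of_real ((-1) ^ m * fact (n - m) * fact (2 * m) / (2 * fact (n + m)) * sinh (max \<sigma> \<sigma>') ^ m * N)"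
      unfolding legendreQ_eq_integral[OF assms(1) cosh_real_gt_1[OF gt(2)]] cosh p_def N_def
      using gt by (simp add: square_powr_half)
    have F: "ferrersP m n (cos \<theta>') = (-1) ^ m * sin \<theta>' ^ m * p (cos \<theta>')"
      unfolding ferrersP_eq_poly sin_squared_eq[symmetric] square_powr_half[OF sin'] p_def by simp
    \<comment> \<open>The square root of \<open>q\<close> is the one in the claim;
      \<open>q\<close>^m supplies the m-th powers in the three associated functions on the
      right.\<close>
    have qp: "q powr (real m + 1/2) = sqrt q * sin \<theta>' ^ m * (sinh (min \<sigma> \<sigma>') ^ m * sinh (max \<sigma> \<sigma>') ^ m)"
    proof -
      have "q powr (real m + 1/2) = sqrt q * q ^ m"
        using q by (simp add: powr_add powr_realpow powr_half_sqrt)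
      also have "q ^ m = sin \<theta>' ^ m * (sinh (min \<sigma> \<sigma>') ^ m * sinh (max \<sigma> \<sigma>') ^ m)"
        unfolding power_mult_distrib[symmetric] sinh_min_max q_def by (simp add: mult_ac)
      finally show ?thesis by simp
    qed
    \<comment> \<open>Both sides equal pi (2m)! ((n - m)! / (n + m)!)^2, since Gamma(m + 1/2) and
      (2m)! share the factor (1/2)_m.\<close>
    have const: "sqrt pi * Gamma (real m + 1/2) / fact m / (p 1)\<^sup>2
        = 2 * pi * fact (n - m) / fact (n + m) * (fact (n - m) * fact (2 * m) / (2 * fact (n + m)))"
      unfolding p_def dlegendre_at_1[OF assms(1)] Gamma_nat_plus_half fact_double_pochhammer_half
      by (simp add: field_simps power2_eq_square flip: power_mult_distrib)
    have "2 * pi * (-1) ^ m * fact (n - m) / fact (n + m) * sqrt q * ferrersP m n (cos \<theta>')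
        * (sinh (min \<sigma> \<sigma>') ^ m * p (cosh (min \<sigma> \<sigma>')))
        * ((-1) ^ m * fact (n - m) * fact (2 * m) / (2 * fact (n + m)) * sinh (max \<sigma> \<sigma>') ^ m * N)
      = (2 * pi * fact (n - m) / fact (n + m) * (fact (n - m) * fact (2 * m) / (2 * fact (n + m))))
        * ((-1) ^ m * (-1) ^ m * (-1) ^ m) * (sqrt q * sin \<theta>' ^ m * (sinh (min \<sigma> \<sigma>') ^ m * sinh (max \<sigma> \<sigma>') ^ m))
        * (p (cos \<theta>') * p (cosh (min \<sigma> \<sigma>')) * N)"
      unfolding F by (simp add: mult_ac)
    also have "(-1) ^ m * (-1) ^ m * (-1) ^ m = ((-1) ^ m :: real)"
      by (simp flip: power_mult_distrib)
    also have "(2 * pi * fact (n - m) / fact (n + m) * (fact (n - m) * fact (2 * m) / (2 * fact (n + m))))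
        * (-1) ^ m * (sqrt q * sin \<theta>' ^ m * (sinh (min \<sigma> \<sigma>') ^ m * sinh (max \<sigma> \<sigma>') ^ m))
        * (p (cos \<theta>') * p (cosh (min \<sigma> \<sigma>')) * N)
       = c * (p (cos \<theta>') * p (cosh (min \<sigma> \<sigma>')) / (p 1)\<^sup>2 * N)"
      unfolding const[symmetric] qp[symmetric] c_def by simp
    finally show ?thesis
      unfolding P Q of_real_mult[symmetric] by (simp only:)
  qed

  have "(?g has_integral p (cos \<theta>') * p (cosh (min \<sigma> \<sigma>')) / (p 1)\<^sup>2 * N) {0..pi}"
    unfolding p_def N_def by (rule ring_integral) (use assms in auto)
  from has_integral_of_real[OF has_integral_mult_right[OF this, of c]]
  have "((\<lambda>\<theta>. complex_of_real (c * ?g \<theta>)) has_integral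
      of_real (c * (p (cos \<theta>') * p (cosh (min \<sigma> \<sigma>')) / (p 1)\<^sup>2 * N))) {0..pi}" .
  \<comment> \<open>The three excluded points are those where the denominator of \<open>chi\<close>
    vanishes or, for \<sigma> = \<sigma>', where \<open>chi\<close> is 1.\<close>
  then show ?thesis
    unfolding rhs[unfolded q_def]
    by (rule has_integral_spike_finite[of "{0, pi, \<theta>'}", rotated 2]) (use lhs in auto)
qed

end
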